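(* Let $Q$ be a semi-Markov kernel on $E=\{1,\ldots,s\}$, let $K=L+Q\star K$ be a Markov renewal equation on $[0,\infty)$ with solution $K$, and let $K_h$ denote the solution of its mean-value discretization with step $h$ (all as defined in the context). Let $T>0$ be fixed, set $N_h=\lfloor T/h\rfloor$, and assume that $K$ is continuous on $[0,T]$. Then there exist $h_0>0$ and $C_T<\infty$, independent of $h$, such that $$\max_{0\leq m\leq N_h}\|K(mh)-K_h(m)\|_F\leq C_T\,\omega_K(h;T),\qquad 0<h\leq h_0.$$ If $K$ is Lipschitz on $[0,T]$ with componentwise constant $L_K(T)$ (that is, $|K_{rj}(t)-K_{rj}(u)|\le L_K(T)|t-u|$ for all $r,j\in E$ and $t,u\in[0,T]$), then for $0<h\le h_0$ $$\max_{0\leq m\leq N_h}\|K(mh)-K_h(m)\|_F\leq C_T L_K(T)h.$$ If, in addition, the entries of $Q$ are absolutely continuous with continuously differentiable densities on $[0,T]$ and the entries of $K$ belong to $C^2([0,T])$, then $$\max_{0\leq m\leq N_h}\|K(mh)-K_h(m)\|_F=\mathcal O(h^2)\qquad (h\to0^+).$$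
   Context: $E=\{1,\ldots,s\}$; $I_s$, $O_s$ are the $s\times s$ identity and zero matrices; $\|\cdot\|_F$ is the Frobenius norm. Semi-Markov kernel: $(J_n,S_n)_{n\ge0}$ is a homogeneous Markov renewal process on $E$ with $S_0=0$, and $Q=(Q_{ij})_{i,j\in E}$ with $Q_{ij}(t)=\mathbb P(J_{n+1}=j,\,S_{n+1}-S_n\le t\mid J_n=i)$. It is assumed that $Q_{ij}(0)=0$, $\sum_{j\in E}Q_{ij}(\infty)=1$ for each $i$, where $Q_{ij}(\infty)=\lim_{t\to\infty}Q_{ij}(t)$, and $S_n\to\infty$ almost surely. In particular each $Q_{ij}$ is nondecreasing and right-continuous on $[0,\infty)$. Stieltjes convolution: for $A$ with right-continuous entries of bounded variation, $A(0)=O_s$, and $B$ with Borel measurable entries bounded on compact intervals, $[A\star B]_{ij}(t)=\sum_{r\in E}\int_{[0,t]}B_{rj}(t-x)\,dA_{ir}(x)$ (Lebesgue–Stieltjes). Continuous equation: $K(t)=L(t)+[Q\star K](t)$, $t\ge0$, where $L,K$ are $s\times s$ matrix functions with Borel measurable entries bounded on compact intervals. Discretization: for $h>0$ put $Q_h(m)=Q(mh)$, $L_h(m)=L(mh)$, $\Delta Q_h(0)=O_s$, $\Delta Q_h(m)=Q_h(m)-Q_h(m-1)$ for $m\ge1$, $\Delta^+Q_h(m)=\Delta Q_h(m+1)$, $\overline Q_h(m)=\tfrac12(\Delta Q_h(m)+\Delta^+Q_h(m))$. Discrete convolution of matrix sequences is $(A*B)(k)=\sum_{\ell=0}^kA(\ell)B(k-\ell)$;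 $e_0$ is the sequence with $e_0(0)=I_s$ and $e_0(k)=O_s$ for $k\ge1$; $K_h(0)e_0$ is the sequence equal to $K_h(0)$ at $0$ and $O_s$ elsewhere. The mean-value approximation $K_h=(K_h(m))_{0\le m\le N_h}$ is the solution of $$K_h=L_h+\overline Q_h*K_h-\tfrac12\Delta^+Q_h*(K_h(0)e_0),\qquad K_h(0)=L_h(0),$$ with all products truncated after coefficient $N_h$; equivalently $$K_h=(e_0-\overline Q_h)^{(-1)}*\bigl[L_h-\tfrac12\Delta^+Q_h*(L_h(0)e_0)\bigr],$$ where $(\cdot)^{(-1)}$ is the convolution inverse. Modulus of continuity: $\omega_K(h;T)=\max_{r,j\in E}\sup\{|K_{rj}(t)-K_{rj}(u)|:0\le t,u\le T,\ |t-u|\le h\}$. *)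

theory Defs
  imports "HOL-Probability.Probability" "HOL-Library.Landau_Symbols"
begin

text \<open>
  The state space is a finite type \<open>'s\<close> (so \<open>s = CARD('s)\<close>), and \<open>s \<times> s\<close> matrices are
  elements of \<open>real ^ 's ^ 's\<close>, whose library norm is the Frobenius norm:
\<close>

lemma norm_eq_frobenius:
  fixes A :: "real ^ 's::finite ^ 's"
  shows "norm A = sqrt (\<Sum>i\<in>UNIV. \<Sum>j\<in>UNIV. (A $ i $ j)\<^sup>2)"
  by (simp add: norm_vec_def L2_set_def sum_nonneg)

text \<open>
  Functions on the half-line are represented by total functions on the reals; every
  definition below depends only on their values at arguments \<open>t \<ge> 0\<close>.
\<close>


section \<open>Markov renewal processes and semi-Markov kernels\<close>

definition mrp_history ::
  "'w measure \<Rightarrow> (nat \<Rightarrow> 'w \<Rightarrow> 's) \<Rightarrow> (nat \<Rightarrow> 'w \<Rightarrow> real) \<Rightarrow> nat \<Rightarrow> 'w measure" where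
  "mrp_history M J S n =
     vimage_algebra (space M) (\<lambda>w. \<lambda>k\<in>{..n}. (J k w, S k w))
       (Pi\<^sub>M {..n} (\<lambda>_. count_space UNIV \<Otimes>\<^sub>M borel))"

definition markov_renewal_process ::
  "'w measure \<Rightarrow> (nat \<Rightarrow> 'w \<Rightarrow> 's::finite) \<Rightarrow> (nat \<Rightarrow> 'w \<Rightarrow> real) \<Rightarrow> bool" where
  "markov_renewal_process M J S \<longleftrightarrow>
     prob_space M \<and>
     (\<forall>n. J n \<in> measurable M (count_space UNIV)) \<and>
     (\<forall>n. S n \<in> borel_measurable M) \<and>
     (AE w in M. S 0 w = 0) \<and>
     (\<forall>n j. \<forall>t\<ge>0.
        let next = indicator {w \<in> space M. J (Suc n) w = j \<and> S (Suc n) w - S n w \<le> t}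
        in AE w in M.
             real_cond_exp M (mrp_history M J S n) next w =
             real_cond_exp M (vimage_algebra (space M) (J n) (count_space UNIV)) next w)"

text \<open>
  \<open>Q\<close> is the semi-Markov kernel of the process \<open>(J, S)\<close>. Homogeneity is expressed by the fact
  that the conditional probability equals \<open>Q t $ i $ j\<close> for every \<open>n\<close>. The conditional
  probability given \<open>J n = i\<close> is only meaningful if \<open>J n = i\<close> has positive probability, so a
  state never visited (under the initial law at hand) leaves its row of \<open>Q\<close> undetermined;
  for such a row only, monotonicity and right-continuity, which for the other rows are
  consequences, are imposed.
\<close>

definition semi_markov_kernel ::
  "'w measure \<Rightarrow> (nat \<Rightarrow> 'w \<Rightarrow> 's::finite) \<Rightarrow> (nat \<Rightarrow> 'w \<Rightarrow> real) \<Rightarrow>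
   (real \<Rightarrow> real ^ 's ^ 's) \<Rightarrow> bool" where
  "semi_markov_kernel M J S Q \<longleftrightarrow>
     markov_renewal_process M J S \<and>
     (\<forall>n i j. \<forall>t\<ge>0. \<P>(w in M. J n w = i) > 0 \<longrightarrow>
        Q t $ i $ j = \<P>(w in M. J (Suc n) w = j \<and> S (Suc n) w - S n w \<le> t \<bar> J n w = i)) \<and>
     (\<forall>i. (\<forall>n. \<P>(w in M. J n w = i) = 0) \<longrightarrow>
        (\<forall>j. mono_on {0..} (\<lambda>t. Q t $ i $ j) \<and>
             (\<forall>t\<ge>0. continuous (at_right t) (\<lambda>t. Q t $ i $ j)))) \<and>
     (\<forall>i j. Q 0 $ i $ j = 0) \<and>
     (\<exists>Qinf. (\<forall>i j. ((\<lambda>t. Q t $ i $ j) \<longlongrightarrow> Qinf i j) at_top) \<and>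
             (\<forall>i. (\<Sum>j\<in>UNIV. Qinf i j) = 1)) \<and>
     (AE w in M. filterlim (\<lambda>n. S n w) at_top sequentially)"


section \<open>The Markov renewal equation\<close>

text \<open>
  Stieltjes convolution, for \<open>A\<close> with nondecreasing right-continuous entries on \<open>{0..}\<close> and
  \<open>A 0 = 0\<close> (in the renewal equation \<open>A\<close> is the kernel). The integrator is extended to the
  negative axis by its value at \<open>0\<close>, as \<^const>\<open>interval_measure\<close> expects a
  nondecreasing right-continuous function on the whole line; no atom arises at \<open>0\<close>.
\<close>

definition stieltjes_conv ::
  "(real \<Rightarrow> real ^ 's::finite ^ 's) \<Rightarrow> (real \<Rightarrow> real ^ 's ^ 's) \<Rightarrow> real \<Rightarrow> real ^ 's ^ 's" where
  "stieltjes_conv A B t =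
     (\<chi> i j. \<Sum>r\<in>UNIV.
        LINT x:{0..t}|interval_measure (\<lambda>x. A (max 0 x) $ i $ r). B (t - x) $ r $ j)"

definition locally_bounded_borel :: "(real \<Rightarrow> real ^ 's::finite ^ 's) \<Rightarrow> bool" where
  "locally_bounded_borel f \<longleftrightarrow>
     (\<forall>i j. set_borel_measurable borel {0..} (\<lambda>t. f t $ i $ j) \<and>
            (\<forall>b. bounded ((\<lambda>t. f t $ i $ j) ` {0..b})))"

definition markov_renewal_solution ::
  "(real \<Rightarrow> real ^ 's::finite ^ 's) \<Rightarrow> (real \<Rightarrow> real ^ 's ^ 's) \<Rightarrow> (real \<Rightarrow> real ^ 's ^ 's) \<Rightarrow> bool"
  where
  "markov_renewal_solution Q L K \<longleftrightarrow>
     locally_bounded_borel L \<and> locally_bounded_borel K \<and>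
     (\<forall>t\<ge>0. K t = L t + stieltjes_conv Q K t)"


section \<open>The mean-value discretization\<close>

definition sampled :: "(real \<Rightarrow> real ^ 's::finite ^ 's) \<Rightarrow> real \<Rightarrow> nat \<Rightarrow> real ^ 's ^ 's" where
  "sampled A h m = A (real m * h)"

definition bdiff :: "(nat \<Rightarrow> real ^ 's::finite ^ 's) \<Rightarrow> nat \<Rightarrow> real ^ 's ^ 's" where
  "bdiff A m = (if m = 0 then 0 else A m - A (m - 1))"

definition fdiff :: "(nat \<Rightarrow> real ^ 's::finite ^ 's) \<Rightarrow> nat \<Rightarrow> real ^ 's ^ 's" where
  "fdiff A m = bdiff A (Suc m)"

definition mean_diff :: "(nat \<Rightarrow> real ^ 's::finite ^ 's) \<Rightarrow> nat \<Rightarrow> real ^ 's ^ 's" where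
  "mean_diff A m = (1/2) *\<^sub>R (bdiff A m + fdiff A m)"

definition seq_conv ::
  "(nat \<Rightarrow> real ^ 's::finite ^ 's) \<Rightarrow> (nat \<Rightarrow> real ^ 's ^ 's) \<Rightarrow> nat \<Rightarrow> real ^ 's ^ 's" where
  "seq_conv A B k = (\<Sum>l\<le>k. A l ** B (k - l))"

definition seq_at_zero :: "real ^ 's::finite ^ 's \<Rightarrow> nat \<Rightarrow> real ^ 's ^ 's" where
  "seq_at_zero A m = (if m = 0 then A else 0)"

text \<open>
  Truncation after coefficient \<open>N\<close> amounts to requiring the equation for \<open>m \<le> N\<close> only. The
  solution exists for every \<open>h > 0\<close> and is unique up to index \<open>N\<close>: the leading coefficient
  \<open>mat 1 - mean_diff (sampled Q h) 0 = mat 1 - (1/2) *\<^sub>R Q h\<close> is invertible, because the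
  entries of \<open>Q h\<close> are nonnegative with row sums at most \<open>1\<close>.
\<close>

definition mean_value_solution ::
  "(real \<Rightarrow> real ^ 's::finite ^ 's) \<Rightarrow> (real \<Rightarrow> real ^ 's ^ 's) \<Rightarrow> real \<Rightarrow> nat \<Rightarrow>
   (nat \<Rightarrow> real ^ 's ^ 's) \<Rightarrow> bool" where
  "mean_value_solution Q L h N X \<longleftrightarrow>
     X 0 = sampled L h 0 \<and>
     (\<forall>m\<le>N. X m = sampled L h m + seq_conv (mean_diff (sampled Q h)) X m
               - (1/2) *\<^sub>R seq_conv (fdiff (sampled Q h)) (seq_at_zero (X 0)) m)"


section \<open>Regularity notions\<close>

definition modulus_of_continuity ::
  "(real \<Rightarrow> real ^ 's::finite ^ 's) \<Rightarrow> real \<Rightarrow> real \<Rightarrow> real" where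
  "modulus_of_continuity K h T =
     (MAX (r, j)\<in>UNIV.
        Sup {\<bar>K t $ r $ j - K u $ r $ j\<bar> | t u.
               0 \<le> t \<and> t \<le> T \<and> 0 \<le> u \<and> u \<le> T \<and> \<bar>t - u\<bar> \<le> h})"

text \<open>Differentiability on a closed interval, one-sided at the end points.\<close>

definition C1_on :: "real set \<Rightarrow> (real \<Rightarrow> real) \<Rightarrow> bool" where
  "C1_on X f \<longleftrightarrow>
     (\<exists>f'. (\<forall>x\<in>X. (f has_real_derivative f' x) (at x within X)) \<and> continuous_on X f')"

definition C2_on :: "real set \<Rightarrow> (real \<Rightarrow> real) \<Rightarrow> bool" where
  "C2_on X f \<longleftrightarrow>
     (\<exists>f'. (\<forall>x\<in>X. (f has_real_derivative f' x) (at x within X)) \<and> C1_on X f')"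

text \<open>
  The function \<open>F\<close>, with \<open>F 0 = 0\<close>, is absolutely continuous on \<open>{0..T}\<close> with a continuously
  differentiable density \<open>q\<close>.
\<close>

definition has_C1_density_on :: "real \<Rightarrow> (real \<Rightarrow> real) \<Rightarrow> bool" where
  "has_C1_density_on T F \<longleftrightarrow>
     (\<exists>q. C1_on {0..T} q \<and> (\<forall>t\<in>{0..T}. F t = (LINT x:{0..t}|lborel. q x)))"

end

theory Submission
  imports Defs
begin

text \<open>
  On the grid, the discretized equation is the renewal equation with the Stieltjes integral over
  each cell replaced by the trapezoid rule, so the error solves a discrete renewal equation whose
  forcing term is the quadrature defect.

  Stability: \<open>Q\<close> is right-continuous with \<open>Q 0 = 0\<close>, so near \<open>0\<close> it carries little mass; in
  a norm with exponentially decaying weights the discrete kernel is then a contraction with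
  constant \<open>1/2\<close>, uniformly in \<open>h\<close>, and the error is bounded by a multiple of the defect.

  Defect: each cell contributes at most the oscillation of \<open>K\<close> times the mass of the cell, and
  the masses sum to at most \<open>1\<close>. In the smooth case, expand \<open>K\<close> at the midpoint \<open>c\<close> of the cell
  \<open>{a<..b}\<close>: the remainder is quadratic in \<open>h\<close>, and the linear term is multiplied by the moment
  \<open>\<integral> (x - c) dQ\<close>, which is cubic since the density is Lipschitz and \<open>\<integral> (x - c) dx = 0\<close>.
\<close>

section \<open>Stability of the discrete renewal equation\<close>

text \<open>The scheme is implicit: for \<open>l = 0\<close> the right-hand side of
  \<open>step\<close> contains \<open>e m\<close> itself, so a plain induction on \<open>m\<close>
  does not close. Instead the largest weighted error \<open>B\<close> is inserted into the
  recursion, and the weight condition turns this into \<open>B \<le> \<rho> + B / 2\<close>.\<close>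

lemma weighted_discrete_gronwall:
  fixes q :: "nat \<Rightarrow> 's::finite \<Rightarrow> 's \<Rightarrow> real" and e :: "nat \<Rightarrow> 's \<Rightarrow> real"
  assumes q: "\<And>l i r. 0 \<le> q l i r" and z: "0 < z" "z \<le> 1"
    and weight: "\<And>i m. m \<le> N \<Longrightarrow> (\<Sum>l<m. \<Sum>r\<in>UNIV. q l i r * z ^ l) \<le> 1 / 2"
    and step: "\<And>m i. m \<le> N \<Longrightarrow>
      \<bar>e m i\<bar> \<le> \<rho> + (\<Sum>l<m. \<Sum>r\<in>UNIV. q l i r * ((\<bar>e (m - Suc l) r\<bar> + \<bar>e (m - l) r\<bar>) / 2))"
    and m: "m \<le> N"
  shows "\<bar>e m i\<bar> * z ^ m \<le> 2 * \<rho>"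
proof -
  define B where "B = (MAX (m, i) \<in> {..N} \<times> UNIV. \<bar>e m i\<bar> * z ^ m)"
  have B: "\<bar>e m i\<bar> * z ^ m \<le> B" if "m \<le> N" for m i
    unfolding B_def using that by (intro Max_ge) (auto intro!: image_eqI[of _ _ "(m, i)"])
  have "0 \<le> \<bar>e 0 i\<bar> * z ^ 0" by simp
  also have "\<dots> \<le> B" by (rule B) simp
  finally have B0: "0 \<le> B" .
  have \<rho>: "0 \<le> \<rho>" using step[of 0 i] by simp
  have bound: "\<bar>e m i\<bar> * z ^ m \<le> \<rho> + B / 2" if m: "m \<le> N" for m i
  proof -
    \<comment> \<open>The weight \<open>z ^ m\<close> is split as \<open>z ^ (m - l) * z ^ l\<close>
      or \<open>z ^ (m - Suc l) * z ^ Suc l\<close>. The first factor is absorbed into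
      \<open>B\<close>, and the surplus factor \<open>z \<le> 1\<close> of the second splitting is
      dropped.\<close>
    have cell: "(\<bar>e (m - Suc l) r\<bar> + \<bar>e (m - l) r\<bar>) / 2 * z ^ m \<le> B * z ^ l" if l: "l < m" for l r
    proof -
      have "\<bar>e (m - l) r\<bar> * z ^ m = \<bar>e (m - l) r\<bar> * z ^ (m - l) * z ^ l"
        using l by (simp add: power_add[symmetric])
      also have "\<dots> \<le> B * z ^ l" using B[of "m - l" r] m z by (intro mult_right_mono) auto
      finally have 1: "\<bar>e (m - l) r\<bar> * z ^ m \<le> B * z ^ l" .
      have "\<bar>e (m - Suc l) r\<bar> * z ^ m = \<bar>e (m - Suc l) r\<bar> * z ^ (m - Suc l) * z ^ Suc l"
        using l by (simp only: mult.assoc power_add[symmetric]) simp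
      also have "\<dots> \<le> B * z ^ Suc l" using B[of "m - Suc l" r] m z by (intro mult_right_mono) auto
      also have "\<dots> \<le> B * z ^ l" using z B0 by (intro mult_left_mono power_decreasing) auto
      finally have 2: "\<bar>e (m - Suc l) r\<bar> * z ^ m \<le> B * z ^ l" .
      show ?thesis using 1 2 by (simp add: field_simps)
    qed
    have "\<bar>e m i\<bar> * z ^ m \<le>
        (\<rho> + (\<Sum>l<m. \<Sum>r\<in>UNIV. q l i r * ((\<bar>e (m - Suc l) r\<bar> + \<bar>e (m - l) r\<bar>) / 2))) * z ^ m"
      using step[OF m] z by (intro mult_right_mono) auto
    also have "\<dots> = \<rho> * z ^ m
        + (\<Sum>l<m. \<Sum>r\<in>UNIV. q l i r * ((\<bar>e (m - Suc l) r\<bar> + \<bar>e (m - l) r\<bar>) / 2 * z ^ m))"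
      by (simp add: distrib_right sum_distrib_right mult.assoc)
    also have "\<dots> \<le> \<rho> * 1 + (\<Sum>l<m. \<Sum>r\<in>UNIV. q l i r * (B * z ^ l))"
      using cell q \<rho> z by (intro add_mono mult_left_mono sum_mono power_le_one) auto
    also have "(\<Sum>l<m. \<Sum>r\<in>UNIV. q l i r * (B * z ^ l)) = B * (\<Sum>l<m. \<Sum>r\<in>UNIV. q l i r * z ^ l)"
      by (simp add: sum_distrib_left algebra_simps)
    also have "\<dots> \<le> B * (1 / 2)" using weight[OF m] B0 by (intro mult_left_mono) auto
    finally show ?thesis by simp
  qed
  \<comment> \<open>The maximum over a finite index set is attained, so \<open>bound\<close> applies
    at a maximizer.\<close>
  have "B \<in> (\<lambda>(m, i). \<bar>e m i\<bar> * z ^ m) ` ({..N} \<times> UNIV)"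
    unfolding B_def by (intro Max_in) auto
  then have "B \<le> \<rho> + B / 2" using bound by auto
  with B[OF m, of i] show ?thesis by simp
qed

section \<open>The trapezoid rule for Stieltjes integrals\<close>

text \<open>Under these two conditions \<open>interval_measure G\<close> gives
  \<open>{a<..b}\<close> the mass \<open>G b - G a\<close>. They are stated on the whole line; a
  kernel entry fits after extension by \<open>x \<mapsto> max 0 x\<close>.\<close>

locale stieltjes_integrator =
  fixes G :: "real \<Rightarrow> real"
  assumes mono: "x \<le> y \<Longrightarrow> G x \<le> G y"
    and right_cont: "continuous (at_right a) G"
begin

lemma finite_Ioc: "emeasure (interval_measure G) {a<..b} < \<infinity>"
  by (simp add: emeasure_interval_measure_Ioc_eq[OF mono right_cont] top.not_eq_extremum[symmetric])

lemma set_integral_const_Ioc: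
  assumes "a \<le> b"
  shows "set_integrable (interval_measure G) {a<..b} (\<lambda>_. c::real)"
    "(LINT x:{a<..b}|interval_measure G. c) = c * (G b - G a)"
  using finite_Ioc[of a b] measure_interval_measure_Ioc[OF assms mono right_cont]
  by (auto simp: set_integrable_def set_lebesgue_integral_def)

text \<open>Continuity at the excluded endpoint \<open>a\<close> matters: compactness of
  \<open>{a..b}\<close> bounds the integrand by a constant, which is integrable because the cell has
  finite mass.\<close>

lemma set_integrable_continuous:
  fixes \<phi> :: "real \<Rightarrow> real"
  assumes "continuous_on {a..b} \<phi>" "a \<le> b"
  shows "set_integrable (interval_measure G) {a<..b} \<phi>"
proof -
  have "bounded (\<phi> ` {a..b})"
    using assms(1) by (intro compact_imp_bounded compact_continuous_image) auto
  then obtain B where "\<forall>y\<in>\<phi> ` {a..b}. norm y \<le> B" unfolding bounded_iff by blast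
  then have B: "\<bar>\<phi> x\<bar> \<le> B" if "x \<in> {a..b}" for x using that by auto
  have "continuous_on {a<..b} \<phi>" using assms by (auto intro: continuous_on_subset)
  then have "set_borel_measurable (interval_measure G) {a<..b} \<phi>"
    unfolding set_borel_measurable_def
    using borel_measurable_continuous_on_indicator[of "{a<..b}" \<phi>] by (simp add: measurable_def)
  then show ?thesis
    using B by (intro set_integrable_bound[OF set_integral_const_Ioc(1)[OF \<open>a \<le> b\<close>, of B]])
      (auto intro!: AE_I2 order_trans[OF B])
qed

lemma abs_set_integral_le:
  fixes \<phi> :: "real \<Rightarrow> real"
  assumes "continuous_on {a..b} \<phi>" "a \<le> b" "\<And>x. x \<in> {a..b} \<Longrightarrow> \<bar>\<phi> x\<bar> \<le> B"
  shows "\<bar>LINT x:{a<..b}|interval_measure G. \<phi> x\<bar> \<le> B * (G b - G a)"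
proof -
  note int = set_integrable_continuous[OF assms(1,2)] set_integral_const_Ioc[OF assms(2)]
  have "(LINT x:{a<..b}|interval_measure G. \<phi> x) \<le> (LINT x:{a<..b}|interval_measure G. B)"
    using assms(3) by (intro set_integral_mono int) (auto simp: abs_le_iff)
  moreover have "(LINT x:{a<..b}|interval_measure G. - B) \<le> (LINT x:{a<..b}|interval_measure G. \<phi> x)"
    using assms(3) by (intro set_integral_mono int) (auto simp: abs_le_iff minus_le_iff)
  ultimately show ?thesis by (simp add: int(3))
qed

text \<open>Half-open cells are disjoint, so an atom of \<open>G\<close> at a grid point is counted
  exactly once.\<close>

lemma set_integral_Ioc_split:
  fixes \<phi> :: "real \<Rightarrow> real"
  assumes "continuous_on {a..c} \<phi>" "a \<le> b" "b \<le> c"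
  shows "(LINT x:{a<..c}|interval_measure G. \<phi> x) =
    (LINT x:{a<..b}|interval_measure G. \<phi> x) + (LINT x:{b<..c}|interval_measure G. \<phi> x)"
proof -
  have eq: "{a<..c} = {a<..b} \<union> {b<..c}" using assms by auto
  have "continuous_on {a..b} \<phi>" "continuous_on {b..c} \<phi>"
    using assms by (auto intro: continuous_on_subset)
  then show ?thesis unfolding eq
    using assms by (intro set_integral_Un set_integrable_continuous) auto
qed

text \<open>Cell errors add up: the masses telescope and the lengths sum to \<open>m h\<close>. The
  bound has two parts because some errors scale with the mass of a cell (\<open>\<epsilon>\<close>)
  and others with its length (\<open>\<eta>\<close>).\<close>

lemma trapezoid_rule_error:
  fixes \<phi> :: "real \<Rightarrow> real"
  assumes cont: "continuous_on {0..real m * h} \<phi>" and h: "0 < h"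
    and cell: "\<And>l. l < m \<Longrightarrow>
      \<bar>LINT x:{real l * h<..real (Suc l) * h}|interval_measure G.
          \<phi> x - (\<phi> (real l * h) + \<phi> (real (Suc l) * h)) / 2\<bar>
        \<le> \<epsilon> * (G (real (Suc l) * h) - G (real l * h)) + \<eta> * h"
  shows "\<bar>(LINT x:{0<..real m * h}|interval_measure G. \<phi> x)
      - (\<Sum>l<m. (G (real (Suc l) * h) - G (real l * h))
            * ((\<phi> (real l * h) + \<phi> (real (Suc l) * h)) / 2))\<bar>
    \<le> \<epsilon> * (G (real m * h) - G 0) + \<eta> * (real m * h)"
  using cont cell
proof (induction m)
  case 0
  then show ?case by (simp add: set_lebesgue_integral_def)
next
  case (Suc m)
  let ?a = "real m * h" and ?b = "real (Suc m) * h"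
  let ?I = "\<lambda>A f. LINT x:A|interval_measure G. f x :: real"
  let ?W = "(\<phi> ?a + \<phi> ?b) / 2"
  let ?S = "\<lambda>m. \<Sum>l<m. (G (real (Suc l) * h) - G (real l * h))
    * ((\<phi> (real l * h) + \<phi> (real (Suc l) * h)) / 2)"
  have ab: "0 \<le> ?a" "?a \<le> ?b" using h by (auto simp: mult_right_mono)
  have c1: "continuous_on {0..?a} \<phi>" and c2: "continuous_on {?a..?b} \<phi>"
    using ab by (auto intro: continuous_on_subset[OF Suc.prems(1)])
  \<comment> \<open>Integrating the constant \<open>?W\<close> over the cell yields exactly the last
    summand of the trapezoid sum.\<close>
  have "?I {?a<..?b} (\<lambda>x. \<phi> x - ?W) = ?I {?a<..?b} \<phi> - ?W * (G ?b - G ?a)"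
    using set_integral_diff(2)[OF set_integrable_continuous[OF c2 ab(2)] set_integral_const_Ioc(1)[OF ab(2)]]
      set_integral_const_Ioc(2)[OF ab(2)] by simp
  moreover have "?I {0<..?b} \<phi> = ?I {0<..?a} \<phi> + ?I {?a<..?b} \<phi>"
    using Suc.prems(1) ab by (intro set_integral_Ioc_split) auto
  ultimately have eq: "?I {0<..?b} \<phi> - ?S (Suc m)
      = (?I {0<..?a} \<phi> - ?S m) + ?I {?a<..?b} (\<lambda>x. \<phi> x - ?W)"
    by (simp add: algebra_simps)
  have "\<bar>?I {0<..?a} \<phi> - ?S m\<bar> \<le> \<epsilon> * (G ?a - G 0) + \<eta> * ?a"
    using Suc.IH[OF c1] Suc.prems(2) by simp
  moreover have "\<bar>?I {?a<..?b} (\<lambda>x. \<phi> x - ?W)\<bar> \<le> \<epsilon> * (G ?b - G ?a) + \<eta> * h"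
    using Suc.prems(2)[of m] by simp
  moreover have "\<epsilon> * (G ?a - G 0) + \<eta> * ?a + (\<epsilon> * (G ?b - G ?a) + \<eta> * h) = \<epsilon> * (G ?b - G 0) + \<eta> * ?b"
    by (simp add: algebra_simps)
  ultimately show ?case unfolding eq by linarith
qed

text \<open>
  No change of variables from \<open>dG\<close> to \<open>q dx\<close> is needed: \<open>\<Phi>\<close> below is differentiable with
  \<open>\<Phi>' y = (y - c) q y\<close> directly from monotonicity, and subtracting \<open>q c (y - c)\<^sup>2 / 2\<close>, which
  takes equal values at \<open>a\<close> and \<open>b\<close>, leaves a derivative of size \<open>(b - a)\<^sup>2\<close>.
\<close>

lemma set_integral_moment_le:
  assumes ab: "a \<le> b"
    and deriv: "\<And>x. x \<in> {a..b} \<Longrightarrow> (G has_real_derivative q x) (at x within {a..b})"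
    and lip: "\<And>x. x \<in> {a..b} \<Longrightarrow> \<bar>q x - q ((a + b) / 2)\<bar> \<le> D * (b - a)"
  shows "\<bar>LINT x:{a<..b}|interval_measure G. x - (a + b) / 2\<bar> \<le> D * (b - a) ^ 3"
proof -
  define c where "c = (a + b) / 2"
  define \<Phi> where "\<Phi> y = (LINT x:{a<..y}|interval_measure G. x - c)" for y
  have incr: "\<Phi> v - \<Phi> u = (LINT x:{u<..v}|interval_measure G. x - c)" if "a \<le> u" "u \<le> v" for u v
    unfolding \<Phi>_def using that
    by (subst set_integral_Ioc_split[of a v _ u]) (auto intro!: continuous_intros)
  \<comment> \<open>On the cell the factor \<open>x - c\<close> differs from \<open>w - c\<close> by
    at most \<open>v - u\<close>. The point \<open>w\<close> is left free because the base point of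
    the difference quotient below may be either endpoint.\<close>
  have close: "\<bar>\<Phi> v - \<Phi> u - (w - c) * (G v - G u)\<bar> \<le> (v - u) * (G v - G u)"
    if uv: "a \<le> u" "u \<le> v" and w: "w \<in> {u..v}" for u v w
  proof -
    have "(LINT x:{u<..v}|interval_measure G. (x - c) - (w - c))
        = (LINT x:{u<..v}|interval_measure G. x - c) - (LINT x:{u<..v}|interval_measure G. w - c)"
      using uv by (intro set_integral_diff set_integrable_continuous continuous_intros) auto
    also have "\<dots> = \<Phi> v - \<Phi> u - (w - c) * (G v - G u)"
      using incr[OF uv] set_integral_const_Ioc(2)[OF uv(2)] by simp
    finally have "\<Phi> v - \<Phi> u - (w - c) * (G v - G u) = (LINT x:{u<..v}|interval_measure G. x - w)"
      by simp
    also have "\<bar>\<dots>\<bar> \<le> (v - u) * (G v - G u)"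
      using uv w by (intro abs_set_integral_le continuous_intros) auto
    finally show ?thesis .
  qed
  \<comment> \<open>The bound on the right tends to \<open>0\<close> as \<open>x\<close> approaches
    \<open>y\<close>, by continuity of \<open>G\<close> there, so the quotient of
    \<open>\<Phi>\<close> has the limit of \<open>y - c\<close> times the quotient of
    \<open>G\<close>.\<close>
  have quot: "\<bar>(\<Phi> x - \<Phi> y) / (x - y) - (y - c) * ((G x - G y) / (x - y))\<bar> \<le> \<bar>G x - G y\<bar>"
    if "x \<noteq> y" "x \<in> {a..b}" "y \<in> {a..b}" for x y
  proof -
    have "\<bar>\<Phi> x - \<Phi> y - (y - c) * (G x - G y)\<bar> \<le> \<bar>x - y\<bar> * \<bar>G x - G y\<bar>"
    proof (cases "y \<le> x")
      case True
      then show ?thesis using close[of y x y] that mono[of y x] by auto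
    next
      case False
      then have "\<bar>\<Phi> y - \<Phi> x - (y - c) * (G y - G x)\<bar> \<le> (y - x) * (G y - G x)"
        using close[of x y y] that by auto
      moreover have "\<Phi> x - \<Phi> y - (y - c) * (G x - G y) = - (\<Phi> y - \<Phi> x - (y - c) * (G y - G x))"
        by (simp add: algebra_simps)
      ultimately show ?thesis using False mono[of x y] by (simp add: abs_minus_commute)
    qed
    moreover have "(\<Phi> x - \<Phi> y) / (x - y) - (y - c) * ((G x - G y) / (x - y))
        = (\<Phi> x - \<Phi> y - (y - c) * (G x - G y)) / (x - y)"
      by (simp add: diff_divide_distrib right_diff_distrib)
    ultimately show ?thesis using that by (simp add: abs_divide divide_le_eq mult.commute)
  qed
  have d\<Phi>: "(\<Phi> has_real_derivative (y - c) * q y) (at y within {a..b})" if y: "y \<in> {a..b}" for y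
    unfolding has_field_derivative_iff
  proof -
    have G: "((\<lambda>x. (G x - G y) / (x - y)) \<longlongrightarrow> q y) (at y within {a..b})"
      using deriv[OF y] by (simp add: has_field_derivative_iff)
    have "(G \<longlongrightarrow> G y) (at y within {a..b})"
      using DERIV_continuous[OF deriv[OF y]] by (simp add: continuous_within)
    then have 0: "((\<lambda>x. \<bar>G x - G y\<bar>) \<longlongrightarrow> 0) (at y within {a..b})"
      by (auto intro!: tendsto_eq_intros)
    have "((\<lambda>x. (\<Phi> x - \<Phi> y) / (x - y) - (y - c) * ((G x - G y) / (x - y))) \<longlongrightarrow> 0) (at y within {a..b})"
      using quot y by (intro Lim_null_comparison[OF _ 0])
        (auto simp: eventually_at_filter intro!: always_eventually)
    from tendsto_add[OF this tendsto_mult_left[OF G, of "y - c"]]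
    show "((\<lambda>x. (\<Phi> x - \<Phi> y) / (x - y)) \<longlongrightarrow> (y - c) * q y) (at y within {a..b})" by simp
  qed
  define \<Psi> where "\<Psi> y = \<Phi> y - q c * ((y - c)\<^sup>2 / 2)" for y
  have "\<bar>\<Psi> b - \<Psi> a\<bar> \<le> D * (b - a)\<^sup>2 * \<bar>b - a\<bar>"
  proof (rule field_differentiable_bound[of "{a..b}" \<Psi> "\<lambda>y. (y - c) * (q y - q c)", unfolded real_norm_def])
    fix y assume y: "y \<in> {a..b}"
    show "(\<Psi> has_real_derivative (y - c) * (q y - q c)) (at y within {a..b})"
    proof -
      have "((\<lambda>y. q c * ((y - c)\<^sup>2 / 2)) has_real_derivative q c * (y - c)) (at y within {a..b})"
        by (auto intro!: derivative_eq_intros)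
      from DERIV_diff[OF d\<Phi>[OF y] this] show ?thesis
        unfolding \<Psi>_def by (simp add: algebra_simps)
    qed
    have "\<bar>(y - c) * (q y - q c)\<bar> \<le> (b - a) * (D * (b - a))"
      unfolding abs_mult using y lip[OF y]
      by (intro mult_mono) (auto simp: c_def abs_le_iff field_simps)
    then show "\<bar>(y - c) * (q y - q c)\<bar> \<le> D * (b - a)\<^sup>2" by (simp add: power2_eq_square mult_ac)
  qed (use ab in auto)
  moreover have "(b - c)\<^sup>2 = (a - c)\<^sup>2" by (simp add: c_def field_simps power2_eq_square)
  then have "\<Psi> b - \<Psi> a = \<Phi> b" by (simp add: \<Psi>_def \<Phi>_def set_lebesgue_integral_def)
  ultimately show ?thesis using ab by (simp add: \<Phi>_def c_def power2_eq_square power3_eq_cube mult.assoc)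
qed

text \<open>The trapezoid value averages two values of \<open>\<phi>\<close>, each within
  \<open>\<epsilon>\<close> of \<open>\<phi> x\<close>.\<close>

lemma local_error_le_oscillation:
  assumes cont: "continuous_on {a..b} \<phi>" and ab: "a \<le> b"
    and osc: "\<And>x y. x \<in> {a..b} \<Longrightarrow> y \<in> {a..b} \<Longrightarrow> \<bar>\<phi> x - \<phi> y\<bar> \<le> \<epsilon>"
  shows "\<bar>LINT x:{a<..b}|interval_measure G. \<phi> x - (\<phi> a + \<phi> b) / 2\<bar> \<le> \<epsilon> * (G b - G a)"
proof (intro abs_set_integral_le continuous_intros cont ab)
  fix x assume "x \<in> {a..b}"
  then show "\<bar>\<phi> x - (\<phi> a + \<phi> b) / 2\<bar> \<le> \<epsilon>"
    using osc[of x a] osc[of x b] ab by (simp add: abs_le_iff field_simps)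
qed

text \<open>The remainder of the expansion is integrated against the mass, the linear term through
  the moment estimate. For \<open>b - a = h\<close> the two summands have the form
  \<open>\<epsilon>\<close> times mass plus \<open>\<eta>\<close> times length, with
  \<open>\<epsilon>\<close> and \<open>\<eta>\<close> of order \<open>h\<close> squared.\<close>

lemma local_error_le_midpoint:
  assumes cont: "continuous_on {a..b} \<phi>" and ab: "a \<le> b"
    and expansion: "\<And>x. x \<in> {a..b} \<Longrightarrow>
      \<bar>\<phi> x - (\<phi> a + \<phi> b) / 2 - p * (x - (a + b) / 2)\<bar> \<le> B * (b - a)\<^sup>2"
    and p: "\<bar>p\<bar> \<le> B"
    and deriv: "\<And>x. x \<in> {a..b} \<Longrightarrow> (G has_real_derivative q x) (at x within {a..b})"
    and lip: "\<And>x y. x \<in> {a..b} \<Longrightarrow> y \<in> {a..b} \<Longrightarrow> \<bar>q x - q y\<bar> \<le> D * \<bar>x - y\<bar>" and D: "0 \<le> D"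
  shows "\<bar>LINT x:{a<..b}|interval_measure G. \<phi> x - (\<phi> a + \<phi> b) / 2\<bar>
    \<le> B * (b - a)\<^sup>2 * (G b - G a) + B * D * (b - a) ^ 3"
proof -
  let ?c = "(a + b) / 2"
  let ?r = "\<lambda>x. \<phi> x - (\<phi> a + \<phi> b) / 2 - p * (x - ?c)"
  have "(LINT x:{a<..b}|interval_measure G. ?r x + p * (x - ?c))
      = (LINT x:{a<..b}|interval_measure G. ?r x) + (LINT x:{a<..b}|interval_measure G. p * (x - ?c))"
    by (intro set_integral_add set_integrable_continuous continuous_intros cont ab)
  then have "(LINT x:{a<..b}|interval_measure G. \<phi> x - (\<phi> a + \<phi> b) / 2)
      = (LINT x:{a<..b}|interval_measure G. ?r x) + p * (LINT x:{a<..b}|interval_measure G. x - ?c)"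
    by simp
  moreover have "\<bar>LINT x:{a<..b}|interval_measure G. ?r x\<bar> \<le> B * (b - a)\<^sup>2 * (G b - G a)"
    by (intro abs_set_integral_le continuous_intros cont ab expansion)
  moreover have "\<bar>LINT x:{a<..b}|interval_measure G. x - ?c\<bar> \<le> D * (b - a) ^ 3"
  proof (rule set_integral_moment_le[OF ab deriv])
    fix x assume x: "x \<in> {a..b}"
    then have "\<bar>q x - q ?c\<bar> \<le> D * \<bar>x - ?c\<bar>" by (intro lip) auto
    also have "\<dots> \<le> D * (b - a)" using x D by (intro mult_left_mono) (auto simp: abs_le_iff field_simps)
    finally show "\<bar>q x - q ?c\<bar> \<le> D * (b - a)" .
  qed
  then have "\<bar>p * (LINT x:{a<..b}|interval_measure G. x - ?c)\<bar> \<le> B * (D * (b - a) ^ 3)"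
    unfolding abs_mult using p by (intro mult_mono) auto
  ultimately show ?thesis by (simp add: mult.assoc)
qed

end

section \<open>Semi-Markov kernels\<close>

text \<open>Immediately to the right of \<open>a\<close> the composition agrees with
  \<open>f\<close> if \<open>0 \<le> a\<close>, and is constant if \<open>a < 0\<close>.\<close>

lemma continuous_at_right_comp_max:
  fixes f :: "real \<Rightarrow> real"
  assumes "\<And>t. 0 \<le> t \<Longrightarrow> continuous (at_right t) f"
  shows "continuous (at_right a) (\<lambda>x. f (max 0 x))"
proof (cases "0 \<le> a")
  case True
  have "\<forall>\<^sub>F x in at_right a. f x = f (max 0 x)"
    using eventually_at_right_less[of a] by eventually_elim (use True in auto)
  then show ?thesis
    using assms[OF True] True unfolding continuous_within by (auto intro: Lim_transform_eventually)
next
  case False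
  have "\<forall>\<^sub>F x in at_right a. f 0 = f (max 0 x)"
    using eventually_at_right_real[of a 0] False by (auto elim!: eventually_mono)
  then show ?thesis
    using False unfolding continuous_within
    by (auto intro: Lim_transform_eventually[OF tendsto_const])
qed

text \<open>The analytic properties of the kernel on which the error estimate rests; the process
  enters only in establishing them.\<close>

locale substochastic_kernel =
  fixes Q :: "real \<Rightarrow> real ^ 's::finite ^ 's"
  assumes integrator: "stieltjes_integrator (\<lambda>x. Q (max 0 x) $ i $ j)"
    and zero: "Q 0 $ i $ j = 0"
    and row_le_1: "0 \<le> t \<Longrightarrow> (\<Sum>j\<in>UNIV. Q t $ i $ j) \<le> 1"

text \<open>For a state visited with positive probability, the kernel entry is a distribution
  function divided by a constant, hence nondecreasing and right-continuous; the other rows have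
  these properties by definition. Monotonicity and the limits at infinity then bound the row
  sums.\<close>

lemma semi_markov_kernel_imp_substochastic:
  fixes Q :: "real \<Rightarrow> real ^ 's::finite ^ 's"
  assumes "semi_markov_kernel M J S Q"
  shows "substochastic_kernel Q"
proof -
  have MRP: "markov_renewal_process M J S"
    and visited: "\<And>n i j t. 0 \<le> t \<Longrightarrow> \<P>(w in M. J n w = i) > 0 \<Longrightarrow>
        Q t $ i $ j = \<P>(w in M. J (Suc n) w = j \<and> S (Suc n) w - S n w \<le> t \<bar> J n w = i)"
    and unvisited: "\<And>i j. \<forall>n. \<P>(w in M. J n w = i) = 0 \<Longrightarrow>
        mono_on {0..} (\<lambda>t. Q t $ i $ j) \<and> (\<forall>t\<ge>0. continuous (at_right t) (\<lambda>t. Q t $ i $ j))"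
    and zero: "\<And>i j. Q 0 $ i $ j = 0"
    and "\<exists>Qinf. (\<forall>i j. ((\<lambda>t. Q t $ i $ j) \<longlongrightarrow> Qinf i j) at_top) \<and> (\<forall>i. (\<Sum>j\<in>UNIV. Qinf i j) = 1)"
    using assms unfolding semi_markov_kernel_def by blast+
  then obtain Qinf where lim: "\<And>i j. ((\<lambda>t. Q t $ i $ j) \<longlongrightarrow> Qinf i j) at_top"
    and Qinf: "\<And>i. (\<Sum>j\<in>UNIV. Qinf i j) = 1" by blast
  interpret prob_space M using MRP by (simp add: markov_renewal_process_def)
  have [measurable]: "J n \<in> measurable M (count_space UNIV)" "S n \<in> borel_measurable M" for n
    using MRP by (auto simp: markov_renewal_process_def)
  have regular: "mono_on {0..} (\<lambda>t. Q t $ i $ j) \<and> (\<forall>t\<ge>0. continuous (at_right t) (\<lambda>t. Q t $ i $ j))"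
    for i j
  proof (cases "\<forall>n. \<P>(w in M. J n w = i) = 0")
    case False
    then obtain n where n: "\<P>(w in M. J n w = i) > 0"
      by (metis measure_nonneg less_le)
    define p where "p = \<P>(w in M. J n w = i)"
    define A where "A = {w \<in> space M. J n w = i \<and> J (Suc n) w = j}"
    define X where "X w = S (Suc n) w - S n w" for w
    have A: "A \<in> sets M" unfolding A_def by measurable
    have X: "X \<in> borel_measurable M" unfolding X_def by measurable
    interpret R: finite_measure "restrict_space M A"
      by (rule finite_measure_restrict_space[OF _ A]) unfold_locales
    \<comment> \<open>Restricting to \<open>A\<close> replaces conditioning: \<open>N\<close> is the
      law of the sojourn time on the event that the step goes from \<open>i\<close> to
      \<open>j\<close>. Its total mass may be below \<open>1\<close>, so it is treated as a finite
      measure.\<close>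
    define N where "N = distr (restrict_space M A) borel X"
    have XR: "X \<in> borel_measurable (restrict_space M A)" by (rule measurable_restrict_space1[OF X])
    interpret N: finite_borel_measure N
      using R.finite_measure_distr[OF XR] by (simp add: N_def finite_borel_measure_def finite_borel_measure_axioms_def)
    have Q: "Q t $ i $ j = cdf N t / p" if "0 \<le> t" for t
    proof -
      have "cdf N t = measure (restrict_space M A) (X -` {..t} \<inter> space (restrict_space M A))"
        unfolding cdf_def N_def by (rule measure_distr[OF XR]) auto
      also have "\<dots> = measure M (X -` {..t} \<inter> space (restrict_space M A))"
        using A sets.sets_into_space[OF A] by (intro measure_restrict_space) (auto simp: space_restrict_space Int_absorb2)
      also have "X -` {..t} \<inter> space (restrict_space M A)
          = {w \<in> space M. (J (Suc n) w = j \<and> S (Suc n) w - S n w \<le> t) \<and> J n w = i}"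
        by (auto simp: space_restrict_space A_def X_def)
      finally show ?thesis unfolding visited[OF that n] cond_prob_def p_def by simp
    qed
    have p: "p > 0" using n by (simp add: p_def)
    have "mono_on {0..} (\<lambda>t. Q t $ i $ j)"
      using p by (auto intro!: mono_onI divide_right_mono N.cdf_nondecreasing simp: Q)
    moreover have "continuous (at_right t) (\<lambda>t. Q t $ i $ j)" if t: "0 \<le> t" for t
    proof -
      have "((\<lambda>t. cdf N t / p) \<longlongrightarrow> cdf N t / p) (at_right t)"
        using N.cdf_is_right_cont[of t] p unfolding continuous_within by (intro tendsto_intros) auto
      moreover have "\<forall>\<^sub>F x in at_right t. cdf N x / p = Q x $ i $ j"
        using eventually_at_right_less[of t] by eventually_elim (use t Q in auto)
      ultimately show ?thesis
        unfolding continuous_within Q[OF t] by (rule Lim_transform_eventually)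
    qed
    ultimately show ?thesis by blast
  qed (use unvisited in blast)
  show ?thesis
  proof
    fix i j
    show "Q (max 0 x) $ i $ j \<le> Q (max 0 y) $ i $ j" if "x \<le> y" for x y
      using regular[of i j] that by (auto dest!: mono_onD[of _ _ "max 0 x" "max 0 y"])
    show "continuous (at_right a) (\<lambda>x. Q (max 0 x) $ i $ j)" for a
      using continuous_at_right_comp_max[of "\<lambda>t. Q t $ i $ j"] regular[of i j] by blast
    show "Q 0 $ i $ j = 0" by (rule zero)
    show "(\<Sum>j\<in>UNIV. Q t $ i $ j) \<le> 1" if t: "0 \<le> t" for t
    proof -
      \<comment> \<open>A nondecreasing function stays below its limit.\<close>
      have "Q t $ i $ j \<le> Qinf i j" for j
      proof (rule tendsto_lowerbound[OF lim])
        show "\<forall>\<^sub>F u in at_top. Q t $ i $ j \<le> Q u $ i $ j"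
          using eventually_ge_at_top[of t]
          by eventually_elim (use t regular[of i j] in \<open>auto elim!: mono_onD\<close>)
      qed simp
      then have "(\<Sum>j\<in>UNIV. Q t $ i $ j) \<le> (\<Sum>j\<in>UNIV. Qinf i j)" by (intro sum_mono)
      then show ?thesis using Qinf[of i] by simp
    qed
  qed
qed

text \<open>
  The correction term at \<open>0\<close> cancels the increment of \<open>Q\<close> beyond the grid point \<open>m h\<close>, which
  leaves exactly the trapezoid rule.
\<close>

lemma mean_value_solution_recursion:
  fixes X :: "nat \<Rightarrow> real ^ 's::finite ^ 's"
  assumes "mean_value_solution Q L h N X" "m \<le> N"
  shows "X m = L (real m * h) + (\<Sum>l<m. (Q (real (Suc l) * h) - Q (real l * h))
      ** ((1 / 2) *\<^sub>R (X (m - Suc l) + X (m - l))))"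
proof -
  let ?A = "sampled Q h"
  let ?d = "\<lambda>l. ?A (Suc l) - ?A l"
  have scale: "(c *\<^sub>R U) ** V = c *\<^sub>R (U ** V)" "U ** (c *\<^sub>R V) = c *\<^sub>R (U ** V)"
    for c and U V :: "real ^ 's ^ 's"
    by (simp_all add: vec_eq_iff matrix_matrix_mult_def sum_distrib_left mult_ac)
  have distrib: "(U + V) ** W = U ** W + V ** W" "W ** (U + V) = W ** U + W ** V"
    for U V W :: "real ^ 's ^ 's"
    by (simp_all add: vec_eq_iff matrix_matrix_mult_def sum.distrib algebra_simps)
  have "seq_conv (mean_diff ?A) X m
      = (1 / 2) *\<^sub>R ((\<Sum>l\<le>m. bdiff ?A l ** X (m - l)) + (\<Sum>l\<le>m. fdiff ?A l ** X (m - l)))"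
    unfolding seq_conv_def mean_diff_def
    by (simp add: scale distrib scaleR_sum_right sum.distrib scaleR_add_right)
  \<comment> \<open>Since \<open>bdiff ?A 0 = 0\<close>, an index shift pairs the increment
    \<open>?d l\<close> with \<open>X (m - Suc l)\<close>. The forward differences pair it with
    \<open>X (m - l)\<close>, but also produce the extra term \<open>?d m ** X 0\<close>.\<close>
  also have "(\<Sum>l\<le>m. bdiff ?A l ** X (m - l)) = (\<Sum>l<m. ?d l ** X (m - Suc l))"
    by (simp add: sum.atMost_shift bdiff_def)
  also have "(\<Sum>l\<le>m. fdiff ?A l ** X (m - l)) = (\<Sum>l<m. ?d l ** X (m - l)) + ?d m ** X 0"
    by (simp add: lessThan_Suc_atMost[symmetric] fdiff_def bdiff_def)
  finally have 1: "seq_conv (mean_diff ?A) X m = (\<Sum>l<m. ?d l ** ((1 / 2) *\<^sub>R (X (m - Suc l) + X (m - l))))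
      + (1 / 2) *\<^sub>R (?d m ** X 0)"
    by (simp add: scale distrib scaleR_sum_right sum.distrib scaleR_add_right)
  have "seq_conv (fdiff ?A) (seq_at_zero (X 0)) m = (\<Sum>l\<le>m. if l = m then ?d m ** X 0 else 0)"
    unfolding seq_conv_def by (intro sum.cong) (auto simp: seq_at_zero_def fdiff_def bdiff_def)
  then have 2: "seq_conv (fdiff ?A) (seq_at_zero (X 0)) m = ?d m ** X 0" by simp
  have "X m = sampled L h m + seq_conv (mean_diff ?A) X m
      - (1/2) *\<^sub>R seq_conv (fdiff ?A) (seq_at_zero (X 0)) m"
    using assms unfolding mean_value_solution_def by blast
  then show ?thesis unfolding 1 2 by (simp add: sampled_def)
qed

section \<open>Consequences of smoothness\<close>

text \<open>The derivative is bounded on the compact interval, and the mean value inequality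
  applies.\<close>

lemma C1_on_lipschitz:
  assumes "C1_on {a..b} f"
  obtains D where "0 \<le> D" "\<And>x y. x \<in> {a..b} \<Longrightarrow> y \<in> {a..b} \<Longrightarrow> \<bar>f x - f y\<bar> \<le> D * \<bar>x - y\<bar>"
proof -
  obtain f' where f': "\<And>x. x \<in> {a..b} \<Longrightarrow> (f has_real_derivative f' x) (at x within {a..b})"
    and "continuous_on {a..b} f'" using assms unfolding C1_on_def by blast
  then have "bounded (f' ` {a..b})" by (intro compact_imp_bounded compact_continuous_image) auto
  then obtain D where D: "D > 0" "\<forall>y\<in>f' ` {a..b}. norm y \<le> D" unfolding bounded_pos by blast
  then have "\<bar>f x - f y\<bar> \<le> D * \<bar>x - y\<bar>" if "x \<in> {a..b}" "y \<in> {a..b}" for x y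
    using field_differentiable_bound[of "{a..b}" f f' D x y] f' that by auto
  then show ?thesis using D(1) by (intro that[of D]) auto
qed

text \<open>The Taylor remainder at the midpoint is quadratic because \<open>f'\<close> is
  Lipschitz. The linear terms at \<open>u\<close> and \<open>v\<close> cancel in the average, so the
  trapezoid value is the midpoint value up to a quadratic error.\<close>

lemma C2_on_midpoint_expansion:
  assumes "C2_on {a..b} f"
  obtains B f' where "0 \<le> B" "\<And>x. x \<in> {a..b} \<Longrightarrow> \<bar>f' x\<bar> \<le> B"
    "\<And>u v y. a \<le> u \<Longrightarrow> u \<le> y \<Longrightarrow> y \<le> v \<Longrightarrow> v \<le> b \<Longrightarrow>
      \<bar>f y - (f u + f v) / 2 - f' ((u + v) / 2) * (y - (u + v) / 2)\<bar> \<le> B * (v - u)\<^sup>2"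
proof -
  obtain f' where f': "\<And>x. x \<in> {a..b} \<Longrightarrow> (f has_real_derivative f' x) (at x within {a..b})"
    and C1: "C1_on {a..b} f'" using assms unfolding C2_on_def by blast
  obtain D where D: "0 \<le> D" "\<And>x y. x \<in> {a..b} \<Longrightarrow> y \<in> {a..b} \<Longrightarrow> \<bar>f' x - f' y\<bar> \<le> D * \<bar>x - y\<bar>"
    using C1_on_lipschitz[OF C1] by blast
  have "continuous_on {a..b} f'"
    using C1 unfolding C1_on_def by (blast intro: DERIV_continuous_on)
  then have "bounded (f' ` {a..b})" by (intro compact_imp_bounded compact_continuous_image) auto
  then obtain B where B: "B > 0" "\<forall>y\<in>f' ` {a..b}. norm y \<le> B" unfolding bounded_pos by blast
  \<comment> \<open>The part \<open>2 * D\<close> collects the remainder at \<open>y\<close> and the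
    mean of those at \<open>u\<close> and \<open>v\<close>; \<open>B\<close> is added so that one
    constant also bounds \<open>f'\<close>.\<close>
  have expansion: "\<bar>f y - (f u + f v) / 2 - f' c * (y - c)\<bar> \<le> (B + 2 * D) * (v - u)\<^sup>2"
    if uv: "a \<le> u" "u \<le> y" "y \<le> v" "v \<le> b" and c: "c = (u + v) / 2" for u v y c
  proof -
    define \<rho> where "\<rho> x = f x - f c - f' c * (x - c)" for x
    have \<rho>: "\<bar>\<rho> x\<bar> \<le> D * (v - u)\<^sup>2" if x: "x \<in> {u..v}" for x
    proof -
      have sub: "{u..v} \<subseteq> {a..b}" using uv by auto
      have cuv: "c \<in> {u..v}" using uv by (auto simp: c)
      have "\<bar>(f x - f' c * (x - c)) - (f c - f' c * (c - c))\<bar> \<le> D * (v - u) * \<bar>x - c\<bar>"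
      proof (rule field_differentiable_bound[of "{u..v}" "\<lambda>x. f x - f' c * (x - c)" "\<lambda>x. f' x - f' c",
            unfolded real_norm_def])
        fix z assume z: "z \<in> {u..v}"
        show "((\<lambda>x. f x - f' c * (x - c)) has_real_derivative f' z - f' c) (at z within {u..v})"
          using DERIV_subset[OF f' sub] z sub by (auto intro!: derivative_eq_intros)
        have "\<bar>f' z - f' c\<bar> \<le> D * \<bar>z - c\<bar>" using z cuv sub by (intro D) auto
        also have "\<dots> \<le> D * (v - u)" using z cuv D(1) by (intro mult_left_mono) auto
        finally show "\<bar>f' z - f' c\<bar> \<le> D * (v - u)" .
      qed (use x cuv in auto)
      also have "\<dots> \<le> D * (v - u) * (v - u)" using x cuv D(1) uv by (intro mult_left_mono) auto
      finally show ?thesis by (simp add: \<rho>_def power2_eq_square algebra_simps)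
    qed
    have "f y - (f u + f v) / 2 - f' c * (y - c) = \<rho> y - (\<rho> u + \<rho> v) / 2"
      by (simp add: \<rho>_def c field_simps)
    also have "\<bar>\<dots>\<bar> \<le> 2 * (D * (v - u)\<^sup>2)"
    proof -
      have "\<bar>r - (s + t) / 2\<bar> \<le> 2 * E" if "\<bar>r\<bar> \<le> E" "\<bar>s\<bar> \<le> E" "\<bar>t\<bar> \<le> E" for r s t E :: real
        using that by (simp add: abs_le_iff field_simps)
      then show ?thesis using \<rho> uv by simp
    qed
    also have "\<dots> \<le> (B + 2 * D) * (v - u)\<^sup>2" using B by (simp add: algebra_simps)
    finally show ?thesis .
  qed
  have "\<bar>f' x\<bar> \<le> B + 2 * D" if "x \<in> {a..b}" for x
  proof -
    have "\<bar>f' x\<bar> \<le> B" using B(2) that by auto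
    then show ?thesis using D(1) by linarith
  qed
  then show ?thesis using B(1) D(1) by (intro that[of "B + 2 * D" f'] expansion) auto
qed

text \<open>For the continuous density the Lebesgue integral equals the gauge integral, to which the
  fundamental theorem of calculus applies.\<close>

lemma has_C1_density_derivative:
  assumes "has_C1_density_on T F"
  obtains q D where "0 \<le> D"
    "\<And>x. x \<in> {0..T} \<Longrightarrow> (F has_real_derivative q x) (at x within {0..T})"
    "\<And>x y. x \<in> {0..T} \<Longrightarrow> y \<in> {0..T} \<Longrightarrow> \<bar>q x - q y\<bar> \<le> D * \<bar>x - y\<bar>"
proof -
  obtain q where C1: "C1_on {0..T} q"
    and F: "\<And>t. t \<in> {0..T} \<Longrightarrow> F t = (LINT x:{0..t}|lborel. q x)"
    using assms unfolding has_C1_density_on_def by blast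
  have cont: "continuous_on {0..T} q"
    using C1 unfolding C1_on_def by (blast intro: DERIV_continuous_on)
  have F': "F t = integral {0..t} q" if t: "t \<in> {0..T}" for t
    unfolding F[OF t] using t
    by (intro set_borel_integral_eq_integral borel_integrable_atLeastAtMost' continuous_on_subset[OF cont]) auto
  have "(F has_real_derivative q x) (at x within {0..T})" if x: "x \<in> {0..T}" for x
    using integral_has_real_derivative[OF cont x] F' unfolding has_field_derivative_def
    by (rule has_derivative_transform[OF x, rotated])
  moreover obtain D where "0 \<le> D"
    "\<And>x y. x \<in> {0..T} \<Longrightarrow> y \<in> {0..T} \<Longrightarrow> \<bar>q x - q y\<bar> \<le> D * \<bar>x - y\<bar>"
    using C1_on_lipschitz[OF C1] by blast
  ultimately show ?thesis using that by blast
qed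

section \<open>The error of the mean-value discretization\<close>

context substochastic_kernel
begin

lemma mono_Q: "0 \<le> s \<Longrightarrow> s \<le> t \<Longrightarrow> Q s $ i $ j \<le> Q t $ i $ j"
  using stieltjes_integrator.mono[OF integrator, of s t i j] by simp

text \<open>Supplies the weight condition of \<open>weighted_discrete_gronwall\<close> with
  \<open>z = exp (- \<gamma> * h)\<close>. As \<open>\<gamma>\<close> is chosen before
  \<open>h\<close> and \<open>m\<close>, removing the weight on \<open>{0..T}\<close> later costs at
  most the factor \<open>exp (\<gamma> * T)\<close>.\<close>

lemma exponential_weight:
  obtains \<gamma> h0 where "0 < \<gamma>" "0 < h0"
    "\<And>h m i. 0 < h \<Longrightarrow> h \<le> h0 \<Longrightarrow>
      (\<Sum>l<m. \<Sum>r\<in>UNIV. (Q (real (Suc l) * h) $ i $ r - Q (real l * h) $ i $ r) * exp (- \<gamma> * h) ^ l) \<le> 1 / 2"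
proof -
  define P where "P i t = (\<Sum>r\<in>UNIV. Q t $ i $ r)" for i t
  have P_mono: "P i s \<le> P i t" if "0 \<le> s" "s \<le> t" for i s t
    unfolding P_def using that by (intro sum_mono mono_Q)
  have P0: "P i 0 = 0" for i by (simp add: P_def zero)
  have P1: "P i t \<le> 1" if "0 \<le> t" for i t unfolding P_def by (rule row_le_1[OF that])
  have "((\<lambda>t. P i (max 0 t)) \<longlongrightarrow> (\<Sum>r\<in>UNIV. Q (max 0 0) $ i $ r)) (at_right 0)" for i
    unfolding P_def using stieltjes_integrator.right_cont[OF integrator]
    unfolding continuous_within by (intro tendsto_sum) blast
  then have "\<forall>\<^sub>F t in at_right 0. P i (max 0 t) < 1 / 4" for i
    by (intro order_tendstoD(2)) (auto simp: zero)
  then have "\<forall>\<^sub>F t in at_right 0. \<forall>i. P i (max 0 t) < 1 / 4" by (rule eventually_all_finite)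
  with eventually_at_right_less[of "0 :: real"]
  have "\<forall>\<^sub>F t in at_right 0. 0 < t \<and> (\<forall>i. P i (max 0 t) < 1 / 4)" by (rule eventually_conj)
  then have "\<exists>t. 0 < t \<and> (\<forall>i. P i (max 0 t) < 1 / 4)" by (rule eventually_happens'[rotated]) simp
  then obtain \<delta> where \<delta>: "0 < \<delta>" "\<And>i. P i (max 0 \<delta>) < 1 / 4" by blast
  then have P\<delta>: "P i \<delta> \<le> 1 / 4" for i by (simp add: less_imp_le max_def)
  show ?thesis
  \<comment> \<open>For \<open>h \<le> \<delta> / 2\<close>, a cell reaching beyond
    \<open>\<delta>\<close> starts at \<open>\<delta> / 2\<close> or later. There the rate
    \<open>6 / \<delta>\<close> makes the exponent at least \<open>3\<close>, and
    \<open>1 + x \<le> exp x\<close> gives a weight of at most \<open>1 / 4\<close>.\<close>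
  proof (rule that[of "6 / \<delta>" "\<delta> / 2"])
    fix h :: real and m i assume h: "0 < h" "h \<le> \<delta> / 2"
    let ?z = "exp (- (6 / \<delta>) * h)"
    have z: "?z ^ l = exp (- (6 / \<delta>) * (real l * h))" for l
      by (simp add: exp_of_nat_mult[symmetric] mult_ac)
    \<comment> \<open>Mass within distance \<open>\<delta>\<close> of \<open>0\<close> is at most \<open>1/4\<close>; the remaining mass has weight at most \<open>1/4\<close>.\<close>
    define R where "R l = min (P i (real l * h)) (P i \<delta>)" for l
    have "(P i (real (Suc l) * h) - P i (real l * h)) * ?z ^ l
        \<le> (R (Suc l) - R l) + (P i (real (Suc l) * h) - P i (real l * h)) / 4" for l
    proof (cases "real (Suc l) * h \<le> \<delta>")
      case True
      have le: "real l * h \<le> real (Suc l) * h" using h by (intro mult_right_mono) auto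
      have d: "0 \<le> P i (real (Suc l) * h) - P i (real l * h)" using P_mono[OF _ le, of i] h by simp
      have "P i (real (Suc l) * h) \<le> P i \<delta>" "P i (real l * h) \<le> P i \<delta>"
        using order_trans[OF le True] True h by (auto intro!: P_mono)
      then have R: "R (Suc l) - R l = P i (real (Suc l) * h) - P i (real l * h)"
        by (simp add: R_def min_def)
      have "(P i (real (Suc l) * h) - P i (real l * h)) * ?z ^ l
          \<le> P i (real (Suc l) * h) - P i (real l * h)"
        using d h \<delta>(1) by (intro mult_left_le power_le_one) auto
      also have "\<dots> \<le> (R (Suc l) - R l) + (P i (real (Suc l) * h) - P i (real l * h)) / 4"
        unfolding R using d by simp
      finally show ?thesis .
    next
      case False
      have le: "real l * h \<le> real (Suc l) * h" using h by (intro mult_right_mono) auto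
      have d: "P i (real l * h) \<le> P i (real (Suc l) * h)" using P_mono[OF _ le, of i] h by simp
      have "real l * h \<ge> \<delta> / 2" using False h by (simp add: algebra_simps)
      then have "3 \<le> (6 / \<delta>) * (real l * h)" using \<delta>(1) by (simp add: field_simps)
      moreover have "1 + (6 / \<delta>) * (real l * h) \<le> exp ((6 / \<delta>) * (real l * h))" by (rule exp_ge_add_one_self)
      ultimately have "4 \<le> exp ((6 / \<delta>) * (real l * h))" by linarith
      then have "?z ^ l \<le> 1 / 4" unfolding z by (simp add: exp_minus field_simps)
      then have "(P i (real (Suc l) * h) - P i (real l * h)) * ?z ^ l
          \<le> (P i (real (Suc l) * h) - P i (real l * h)) * (1 / 4)"
        using d by (intro mult_left_mono) auto
      also have "\<dots> \<le> (R (Suc l) - R l) + (P i (real (Suc l) * h) - P i (real l * h)) / 4"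
      proof -
        have "R l \<le> R (Suc l)" using d by (auto simp: R_def)
        then show ?thesis by simp
      qed
      finally show ?thesis .
    qed
    then have "(\<Sum>l<m. (P i (real (Suc l) * h) - P i (real l * h)) * ?z ^ l)
        \<le> (\<Sum>l<m. (R (Suc l) - R l) + (P i (real (Suc l) * h) - P i (real l * h)) / 4)"
      by (intro sum_mono)
    also have "\<dots> = (\<Sum>l<m. R (Suc l) - R l) + (\<Sum>l<m. P i (real (Suc l) * h) - P i (real l * h)) / 4"
      by (simp only: sum.distrib sum_divide_distrib)
    also have "\<dots> = (R m - R 0) + (P i (real m * h) - P i (real 0 * h)) / 4"
      using sum_lessThan_telescope[of R m] sum_lessThan_telescope[of "\<lambda>l. P i (real l * h)" m] by simp
    also have "\<dots> \<le> 1 / 2"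
    proof -
      have "R 0 = 0" using P_mono[of 0 \<delta> i] \<delta>(1) by (simp add: R_def P0)
      moreover have "R m \<le> 1 / 4" using P\<delta>[of i] by (simp add: R_def)
      moreover have "P i (real m * h) \<le> 1" using h by (intro P1) auto
      ultimately show ?thesis by (simp add: P0)
    qed
    also have "(\<Sum>l<m. (P i (real (Suc l) * h) - P i (real l * h)) * ?z ^ l)
        = (\<Sum>l<m. \<Sum>r\<in>UNIV. (Q (real (Suc l) * h) $ i $ r - Q (real l * h) $ i $ r) * ?z ^ l)"
      by (simp only: P_def sum_subtractf[symmetric] sum_distrib_right)
    finally show "(\<Sum>l<m. \<Sum>r\<in>UNIV. (Q (real (Suc l) * h) $ i $ r - Q (real l * h) $ i $ r) * ?z ^ l) \<le> 1 / 2" .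
  qed (use \<delta> in auto)
qed

text \<open>The extended integrator is constant on \<open>{-1..0}\<close>, so there is no atom at
  \<open>0\<close> and the closed interval may be replaced by the half-open one on which the cells
  are built.\<close>

lemma stieltjes_conv_nth:
  "stieltjes_conv Q B t $ i $ j =
    (\<Sum>r\<in>UNIV. LINT x:{0<..t}|interval_measure (\<lambda>x. Q (max 0 x) $ i $ r). B (t - x) $ r $ j)"
proof -
  have "emeasure (interval_measure (\<lambda>x. Q (max 0 x) $ i $ r)) {0} = 0" for r
  proof -
    interpret stieltjes_integrator "\<lambda>x. Q (max 0 x) $ i $ r" by (rule integrator)
    have "emeasure (interval_measure (\<lambda>x. Q (max 0 x) $ i $ r)) {0}
        \<le> emeasure (interval_measure (\<lambda>x. Q (max 0 x) $ i $ r)) {-1<..0}"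
      by (intro emeasure_mono) auto
    also have "\<dots> = 0" by (simp add: emeasure_interval_measure_Ioc_eq[OF mono right_cont])
    finally show ?thesis by simp
  qed
  then show ?thesis unfolding stieltjes_conv_def vec_lambda_beta
    by (intro sum.cong refl set_integral_discrete_difference[where X = "{0}"]) auto
qed

text \<open>Combines stability with an arbitrary bound on the cell defects, so that both the
  oscillation estimate and the second-order estimate can be inserted. \<open>h0\<close> and
  \<open>C\<close> are fixed before \<open>h\<close>, \<open>\<epsilon>\<close> and
  \<open>\<eta>\<close>.\<close>

lemma mean_value_error:
  fixes L K :: "real \<Rightarrow> real ^ 's ^ 's" and Kh :: "real \<Rightarrow> nat \<Rightarrow> real ^ 's ^ 's"
  assumes renewal: "\<And>t. 0 \<le> t \<Longrightarrow> K t = L t + stieltjes_conv Q K t"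
    and discrete: "\<And>h. 0 < h \<Longrightarrow> mean_value_solution Q L h (nat \<lfloor>T / h\<rfloor>) (Kh h)"
    and T: "0 < T" and cont: "continuous_on {0..T} K"
  obtains h0 C where "0 < h0" "0 \<le> C"
    "\<And>h \<epsilon> \<eta> m. 0 < h \<Longrightarrow> h \<le> h0 \<Longrightarrow> 0 \<le> \<epsilon> \<Longrightarrow> 0 \<le> \<eta> \<Longrightarrow>
      (\<And>t a i r j. 0 \<le> a \<Longrightarrow> a + h \<le> t \<Longrightarrow> t \<le> T \<Longrightarrow>
        \<bar>LINT x:{a<..a + h}|interval_measure (\<lambda>x. Q (max 0 x) $ i $ r).
          K (t - x) $ r $ j - (K (t - a) $ r $ j + K (t - (a + h)) $ r $ j) / 2\<bar>
        \<le> \<epsilon> * (Q (a + h) $ i $ r - Q a $ i $ r) + \<eta> * h) \<Longrightarrow>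
      m \<le> nat \<lfloor>T / h\<rfloor> \<Longrightarrow> norm (K (real m * h) - Kh h m) \<le> C * (\<epsilon> + \<eta>)"
proof -
  obtain \<gamma> h0 where \<gamma>: "0 < \<gamma>" and h0: "0 < h0"
    and weight: "\<And>h m i. 0 < h \<Longrightarrow> h \<le> h0 \<Longrightarrow>
      (\<Sum>l<m. \<Sum>r\<in>UNIV. (Q (real (Suc l) * h) $ i $ r - Q (real l * h) $ i $ r) * exp (- \<gamma> * h) ^ l) \<le> 1 / 2"
    using exponential_weight by blast
  let ?s = "real CARD('s)"
  \<comment> \<open>The factor \<open>?s * ?s\<close> passes from entries to the Frobenius norm,
    \<open>2 * exp (\<gamma> * T)\<close> comes from the weighted Gronwall bound, and
    \<open>1 + ?s * T\<close> dominates the coefficients of the forcing term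
    \<open>?\<rho>\<close>.\<close>
  define C where "C = ?s * ?s * (2 * exp (\<gamma> * T)) * (1 + ?s * T)"
  show ?thesis
  proof (rule that[of h0 C])
    show "0 \<le> C" using T by (simp add: C_def)
    fix h \<epsilon> \<eta> :: real and m
    assume h: "0 < h" "h \<le> h0" and \<epsilon>: "0 \<le> \<epsilon>" and \<eta>: "0 \<le> \<eta>"
      and cell: "\<And>t a i r j. 0 \<le> a \<Longrightarrow> a + h \<le> t \<Longrightarrow> t \<le> T \<Longrightarrow>
        \<bar>LINT x:{a<..a + h}|interval_measure (\<lambda>x. Q (max 0 x) $ i $ r).
          K (t - x) $ r $ j - (K (t - a) $ r $ j + K (t - (a + h)) $ r $ j) / 2\<bar>
        \<le> \<epsilon> * (Q (a + h) $ i $ r - Q a $ i $ r) + \<eta> * h"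
      and m: "m \<le> nat \<lfloor>T / h\<rfloor>"
    let ?N = "nat \<lfloor>T / h\<rfloor>"
    let ?q = "\<lambda>l i r. Q (real (Suc l) * h) $ i $ r - Q (real l * h) $ i $ r"
    let ?\<rho> = "\<epsilon> + ?s * (\<eta> * T)"
    have grid: "real m * h \<le> T" if "m \<le> ?N" for m
    proof -
      have "real m \<le> real (nat \<lfloor>T / h\<rfloor>)" using that by simp
      also have "\<dots> \<le> T / h" using T h by (intro of_nat_floor) auto
      finally have "real m \<le> T / h" .
      then show ?thesis using h by (simp add: field_simps)
    qed
    have q: "0 \<le> ?q l i r" for l i r
      using h mono_Q[of "real l * h" "real (Suc l) * h" i r] by (simp add: mult_right_mono)
    have entry: "\<bar>(K (real m * h) - Kh h m) $ i $ j\<bar> \<le> 2 * exp (\<gamma> * T) * ?\<rho>" if m: "m \<le> ?N" for m i j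
    proof -
      \<comment> \<open>The matrix equation acts on columns separately; with \<open>j\<close> fixed,
        the error is a vector indexed by states.\<close>
      define e where "e m i = (K (real m * h) - Kh h m) $ i $ j" for m i
      have step: "\<bar>e m i\<bar> \<le> ?\<rho> + (\<Sum>l<m. \<Sum>r\<in>UNIV. ?q l i r * ((\<bar>e (m - Suc l) r\<bar> + \<bar>e (m - l) r\<bar>) / 2))"
        if m: "m \<le> ?N" for m i
      proof -
        let ?t = "real m * h"
        let ?I = "\<lambda>r. LINT x:{0<..?t}|interval_measure (\<lambda>x. Q (max 0 x) $ i $ r). K (?t - x) $ r $ j"
        let ?W = "\<lambda>l r. (K (?t - real l * h) $ r $ j + K (?t - real (Suc l) * h) $ r $ j) / 2"
        have defect: "\<bar>?I r - (\<Sum>l<m. ?q l i r * ?W l r)\<bar> \<le> \<epsilon> * Q ?t $ i $ r + \<eta> * T" for r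
        proof -
          interpret stieltjes_integrator "\<lambda>x. Q (max 0 x) $ i $ r" by (rule integrator)
          have pos: "max 0 (real l * h) = real l * h" "max 0 (real (Suc l) * h) = real (Suc l) * h" for l
            using h by auto
          have "\<bar>?I r - (\<Sum>l<m. (Q (max 0 (real (Suc l) * h)) $ i $ r - Q (max 0 (real l * h)) $ i $ r) * ?W l r)\<bar>
            \<le> \<epsilon> * (Q (max 0 ?t) $ i $ r - Q (max 0 0) $ i $ r) + \<eta> * ?t"
          proof (rule trapezoid_rule_error)
            show "continuous_on {0..?t} (\<lambda>x. K (?t - x) $ r $ j)"
              using grid[OF m] h
              by (intro continuous_intros continuous_on_compose2[OF cont]) auto
            fix l assume "l < m"
            then have "real (Suc l) * h \<le> ?t" using h by (intro mult_right_mono) auto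
            then show "\<bar>LINT x:{real l * h<..real (Suc l) * h}|interval_measure (\<lambda>x. Q (max 0 x) $ i $ r).
                K (?t - x) $ r $ j - ?W l r\<bar>
              \<le> \<epsilon> * (Q (max 0 (real (Suc l) * h)) $ i $ r - Q (max 0 (real l * h)) $ i $ r) + \<eta> * h"
              using cell[of "real l * h" ?t i r j] grid[OF m] h unfolding pos by (simp add: algebra_simps)
          qed (use h in auto)
          also have "\<dots> \<le> \<epsilon> * Q ?t $ i $ r + \<eta> * T"
            using h \<eta> grid[OF m] by (simp add: zero mult_left_mono)
          finally show ?thesis unfolding pos .
        qed
        \<comment> \<open>Subtracting the two equations at \<open>?t\<close> cancels
          \<open>L\<close>. What remains is the quadrature defect plus the discrete kernel applied
          to the error, because \<open>?t - real l * h\<close> is again a grid point.\<close>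
        have "K ?t $ i $ j = L ?t $ i $ j + (\<Sum>r\<in>UNIV. ?I r)"
          using renewal[of ?t] h by (simp add: stieltjes_conv_nth)
        moreover have "Kh h m $ i $ j = L ?t $ i $ j
            + (\<Sum>r\<in>UNIV. \<Sum>l<m. ?q l i r * ((Kh h (m - Suc l) $ r $ j + Kh h (m - l) $ r $ j) / 2))"
          by (subst mean_value_solution_recursion[OF discrete[OF h(1)] m], subst sum.swap)
            (simp add: matrix_matrix_mult_def)
        ultimately have "e m i = (\<Sum>r\<in>UNIV. ?I r - (\<Sum>l<m. ?q l i r * ?W l r))
          + (\<Sum>r\<in>UNIV. \<Sum>l<m. ?q l i r * (?W l r - (Kh h (m - Suc l) $ r $ j + Kh h (m - l) $ r $ j) / 2))"
          by (simp add: e_def sum_subtractf right_diff_distrib)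
        also have "(\<Sum>r\<in>UNIV. \<Sum>l<m. ?q l i r * (?W l r - (Kh h (m - Suc l) $ r $ j + Kh h (m - l) $ r $ j) / 2))
          = (\<Sum>r\<in>UNIV. \<Sum>l<m. ?q l i r * ((e (m - Suc l) r + e (m - l) r) / 2))"
        proof (intro sum.cong refl)
          fix r l assume "l \<in> {..<m}"
          then have "?t - real l * h = real (m - l) * h" "?t - real (Suc l) * h = real (m - Suc l) * h"
            by (auto simp: of_nat_diff algebra_simps)
          then show "?q l i r * (?W l r - (Kh h (m - Suc l) $ r $ j + Kh h (m - l) $ r $ j) / 2)
            = ?q l i r * ((e (m - Suc l) r + e (m - l) r) / 2)"
            by (simp add: e_def field_simps)
        qed
        finally have "\<bar>e m i\<bar> = \<bar>(\<Sum>r\<in>UNIV. ?I r - (\<Sum>l<m. ?q l i r * ?W l r))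
            + (\<Sum>r\<in>UNIV. \<Sum>l<m. ?q l i r * ((e (m - Suc l) r + e (m - l) r) / 2))\<bar>"
          by (rule arg_cong)
        also have "\<dots> \<le> (\<Sum>r\<in>UNIV. \<epsilon> * Q ?t $ i $ r + \<eta> * T)
            + (\<Sum>r\<in>UNIV. \<Sum>l<m. ?q l i r * ((\<bar>e (m - Suc l) r\<bar> + \<bar>e (m - l) r\<bar>) / 2))"
        proof (intro order_trans[OF abs_triangle_ineq] add_mono)
          have "\<bar>\<Sum>r\<in>UNIV. ?I r - (\<Sum>l<m. ?q l i r * ?W l r)\<bar> \<le> (\<Sum>r\<in>UNIV. \<bar>?I r - (\<Sum>l<m. ?q l i r * ?W l r)\<bar>)"
            by (rule sum_abs)
          also have "\<dots> \<le> (\<Sum>r\<in>UNIV. \<epsilon> * Q ?t $ i $ r + \<eta> * T)" by (rule sum_mono) (rule defect)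
          finally show "\<bar>\<Sum>r\<in>UNIV. ?I r - (\<Sum>l<m. ?q l i r * ?W l r)\<bar> \<le> (\<Sum>r\<in>UNIV. \<epsilon> * Q ?t $ i $ r + \<eta> * T)" .
          let ?f = "\<lambda>r l. ?q l i r * ((e (m - Suc l) r + e (m - l) r) / 2)"
          have "\<bar>\<Sum>r\<in>UNIV. \<Sum>l<m. ?f r l\<bar> \<le> (\<Sum>r\<in>UNIV. \<bar>\<Sum>l<m. ?f r l\<bar>)" by (rule sum_abs)
          also have "\<dots> \<le> (\<Sum>r\<in>UNIV. \<Sum>l<m. \<bar>?f r l\<bar>)" by (rule sum_mono) (rule sum_abs)
          also have "\<dots> \<le> (\<Sum>r\<in>UNIV. \<Sum>l<m. ?q l i r * ((\<bar>e (m - Suc l) r\<bar> + \<bar>e (m - l) r\<bar>) / 2))"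
          proof (rule sum_mono, rule sum_mono)
            fix r l
            show "\<bar>?f r l\<bar> \<le> ?q l i r * ((\<bar>e (m - Suc l) r\<bar> + \<bar>e (m - l) r\<bar>) / 2)"
              unfolding abs_mult abs_of_nonneg[OF q] using q by (intro mult_left_mono) auto
          qed
          finally show "\<bar>\<Sum>r\<in>UNIV. \<Sum>l<m. ?f r l\<bar>
            \<le> (\<Sum>r\<in>UNIV. \<Sum>l<m. ?q l i r * ((\<bar>e (m - Suc l) r\<bar> + \<bar>e (m - l) r\<bar>) / 2))" .
        qed
        also have "\<dots> \<le> ?\<rho> + (\<Sum>r\<in>UNIV. \<Sum>l<m. ?q l i r * ((\<bar>e (m - Suc l) r\<bar> + \<bar>e (m - l) r\<bar>) / 2))"
        proof (rule add_right_mono)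
          have "(\<Sum>r\<in>UNIV. \<epsilon> * Q ?t $ i $ r + \<eta> * T) = \<epsilon> * (\<Sum>r\<in>UNIV. Q ?t $ i $ r) + ?s * (\<eta> * T)"
            by (simp add: sum.distrib sum_distrib_left)
          also have "\<dots> \<le> \<epsilon> * 1 + ?s * (\<eta> * T)"
            using \<epsilon> h by (intro add_right_mono mult_left_mono row_le_1) auto
          finally show "(\<Sum>r\<in>UNIV. \<epsilon> * Q ?t $ i $ r + \<eta> * T) \<le> ?\<rho>" by simp
        qed
        also have "(\<Sum>r\<in>UNIV. \<Sum>l<m. ?q l i r * ((\<bar>e (m - Suc l) r\<bar> + \<bar>e (m - l) r\<bar>) / 2))
          = (\<Sum>l<m. \<Sum>r\<in>UNIV. ?q l i r * ((\<bar>e (m - Suc l) r\<bar> + \<bar>e (m - l) r\<bar>) / 2))"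
          by (rule sum.swap)
        finally show ?thesis .
      qed
      have "\<bar>e m i\<bar> * exp (- \<gamma> * h) ^ m \<le> 2 * ?\<rho>"
        by (rule weighted_discrete_gronwall[of ?q "exp (- \<gamma> * h)" ?N e ?\<rho>])
          (use q weight[OF h] \<gamma> h step m in auto)
      \<comment> \<open>Multiplication by \<open>exp (\<gamma> * (real m * h))\<close> undoes the
        weight.\<close>
      then have "\<bar>e m i\<bar> * exp (- \<gamma> * h) ^ m * exp (\<gamma> * (real m * h)) \<le> 2 * ?\<rho> * exp (\<gamma> * (real m * h))"
        by (intro mult_right_mono) auto
      moreover have "exp (- \<gamma> * h) ^ m * exp (\<gamma> * (real m * h)) = 1"
        by (simp add: exp_of_nat_mult[symmetric] mult_exp_exp mult_ac)
      then have "\<bar>e m i\<bar> = \<bar>e m i\<bar> * exp (- \<gamma> * h) ^ m * exp (\<gamma> * (real m * h))"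
        by (simp only: mult.assoc mult_1_right)
      ultimately have "\<bar>e m i\<bar> \<le> 2 * ?\<rho> * exp (\<gamma> * (real m * h))"
        by (rule ord_eq_le_trans[rotated])
      also have "\<dots> \<le> 2 * ?\<rho> * exp (\<gamma> * T)"
        using grid[OF m] \<gamma> \<epsilon> \<eta> T by (intro mult_left_mono) auto
      finally show ?thesis by (simp only: e_def mult_ac)
    qed
    have "norm (K (real m * h) - Kh h m) \<le> (\<Sum>i\<in>UNIV. norm ((K (real m * h) - Kh h m) $ i))"
      by (simp add: norm_vec_def L2_set_le_sum)
    also have "\<dots> \<le> (\<Sum>i\<in>UNIV. \<Sum>j\<in>UNIV. \<bar>(K (real m * h) - Kh h m) $ i $ j\<bar>)"
      by (intro sum_mono norm_le_l1_cart)
    also have "\<dots> \<le> (\<Sum>i\<in>(UNIV :: 's set). \<Sum>j\<in>(UNIV :: 's set). 2 * exp (\<gamma> * T) * ?\<rho>)"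
      by (intro sum_mono entry m)
    also have "\<dots> = ?s * ?s * (2 * exp (\<gamma> * T)) * ?\<rho>" by simp
    also have "\<dots> \<le> ?s * ?s * (2 * exp (\<gamma> * T)) * ((1 + ?s * T) * (\<epsilon> + \<eta>))"
      using \<epsilon> \<eta> T by (intro mult_left_mono) (auto simp: algebra_simps)
    finally show "norm (K (real m * h) - Kh h m) \<le> C * (\<epsilon> + \<eta>)" by (simp add: C_def mult.assoc)
  qed (rule h0)
qed

end

section \<open>Modulus of continuity and uniform constants\<close>

lemma abs_diff_le_modulus:
  assumes cont: "continuous_on {0..T} K" and t: "t \<in> {0..T}" and u: "u \<in> {0..T}" and h: "\<bar>t - u\<bar> \<le> h"
  shows "\<bar>K t $ r $ j - K u $ r $ j\<bar> \<le> modulus_of_continuity K h T"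
proof -
  let ?A = "\<lambda>r j. {\<bar>K t $ r $ j - K u $ r $ j\<bar> | t u. 0 \<le> t \<and> t \<le> T \<and> 0 \<le> u \<and> u \<le> T \<and> \<bar>t - u\<bar> \<le> h}"
  have "bounded ((\<lambda>t. K t $ r $ j) ` {0..T})"
    by (intro compact_imp_bounded compact_continuous_image continuous_intros cont) auto
  then obtain B where B: "\<forall>y\<in>(\<lambda>t. K t $ r $ j) ` {0..T}. norm y \<le> B" unfolding bounded_iff by blast
  \<comment> \<open>A real \<open>Sup\<close> dominates its elements only for a set bounded above;
    here compactness of \<open>{0..T}\<close> provides the bound.\<close>
  have "bdd_above (?A r j)"
  proof (rule bdd_aboveI[of _ "2 * B"])
    fix x assume "x \<in> ?A r j"
    then obtain t u where tu: "x = \<bar>K t $ r $ j - K u $ r $ j\<bar>" "t \<in> {0..T}" "u \<in> {0..T}" by auto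
    have "\<bar>K t $ r $ j\<bar> \<le> B" "\<bar>K u $ r $ j\<bar> \<le> B" using B tu by auto
    then show "x \<le> 2 * B" unfolding tu(1) by linarith
  qed
  then have "\<bar>K t $ r $ j - K u $ r $ j\<bar> \<le> Sup (?A r j)"
    using t u h by (intro cSup_upper) auto
  also have "\<dots> \<le> modulus_of_continuity K h T"
    unfolding modulus_of_continuity_def by (intro Max_ge) (auto intro!: image_eqI[of _ _ "(r, j)"])
  finally show ?thesis .
qed

lemma modulus_le_lipschitz:
  assumes lip: "\<And>r j t u. t \<in> {0..T} \<Longrightarrow> u \<in> {0..T} \<Longrightarrow> \<bar>K t $ r $ j - K u $ r $ j\<bar> \<le> Lip * \<bar>t - u\<bar>"
    and T: "0 < T" and h: "0 \<le> h"
  shows "modulus_of_continuity K h T \<le> Lip * h"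
proof -
  \<comment> \<open>The sign of \<open>Lip\<close> is obtained from the hypothesis at the distinct
    points \<open>0\<close> and \<open>T\<close>; \<open>undefined\<close> stands for an arbitrary
    matrix index.\<close>
  have "0 \<le> Lip * T" using order_trans[OF abs_ge_zero lip[of 0 T undefined undefined]] T by simp
  then have Lip: "0 \<le> Lip" using T by (simp add: zero_le_mult_iff)
  have "Sup {\<bar>K t $ r $ j - K u $ r $ j\<bar> | t u. 0 \<le> t \<and> t \<le> T \<and> 0 \<le> u \<and> u \<le> T \<and> \<bar>t - u\<bar> \<le> h} \<le> Lip * h"
    for r j
  proof (rule cSup_least)
    show "{\<bar>K t $ r $ j - K u $ r $ j\<bar> | t u. 0 \<le> t \<and> t \<le> T \<and> 0 \<le> u \<and> u \<le> T \<and> \<bar>t - u\<bar> \<le> h} \<noteq> {}"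
      using T h by (auto intro!: exI[of _ 0])
    fix x assume "x \<in> {\<bar>K t $ r $ j - K u $ r $ j\<bar> | t u. 0 \<le> t \<and> t \<le> T \<and> 0 \<le> u \<and> u \<le> T \<and> \<bar>t - u\<bar> \<le> h}"
    then obtain t u where tu: "x = \<bar>K t $ r $ j - K u $ r $ j\<bar>" "t \<in> {0..T}" "u \<in> {0..T}" "\<bar>t - u\<bar> \<le> h"
      by auto
    then show "x \<le> Lip * h" using lip[OF tu(2,3), of r j] mult_left_mono[OF tu(4) Lip] by linarith
  qed
  then show ?thesis unfolding modulus_of_continuity_def by (intro Max.boundedI) auto
qed

text \<open>The sum of the absolute values of the individual bounds dominates each of them. This
  merges constants depending on a matrix entry into one.\<close>

lemma finite_uniform_bound:
  fixes P :: "'a::finite \<Rightarrow> real \<Rightarrow> bool"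
  assumes "\<And>i. \<exists>B. P i B" and "\<And>i B B'. P i B \<Longrightarrow> B \<le> B' \<Longrightarrow> P i B'"
  obtains B where "0 \<le> B" "\<And>i. P i B"
proof -
  obtain b where b: "\<And>i. P i (b i)" using assms(1) by metis
  show ?thesis
  proof (rule that[of "\<Sum>i\<in>UNIV. \<bar>b i\<bar>"])
    fix i
    have "b i \<le> \<bar>b i\<bar>" by simp
    also have "\<dots> \<le> (\<Sum>i\<in>UNIV. \<bar>b i\<bar>)" by (rule member_le_sum) auto
    finally show "P i (\<Sum>i\<in>UNIV. \<bar>b i\<bar>)" by (rule assms(2)[OF b])
  qed (simp add: sum_nonneg)
qed

section \<open>The three convergence estimates\<close>

theorem theorem4p1:
  fixes M :: "'w measure"
    and J :: "nat \<Rightarrow> 'w \<Rightarrow> 's::finite"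
    and S :: "nat \<Rightarrow> 'w \<Rightarrow> real"
    and Q L K :: "real \<Rightarrow> real ^ 's ^ 's"
    and Kh :: "real \<Rightarrow> nat \<Rightarrow> real ^ 's ^ 's"
    and T :: real
  assumes kernel: "semi_markov_kernel M J S Q"
    and renewal: "markov_renewal_solution Q L K"
    and discrete: "\<And>h. h > 0 \<Longrightarrow> mean_value_solution Q L h (nat \<lfloor>T / h\<rfloor>) (Kh h)"
    and T_pos: "T > 0"
    and K_cont: "continuous_on {0..T} K"
  shows "(\<exists>h0>0. \<exists>C.
            (\<forall>h. 0 < h \<and> h \<le> h0 \<longrightarrow>
               (MAX m\<in>{..nat \<lfloor>T / h\<rfloor>}. norm (K (real m * h) - Kh h m))
                 \<le> C * modulus_of_continuity K h T) \<and>
            (\<forall>Lip. (\<forall>r j. \<forall>t\<in>{0..T}. \<forall>u\<in>{0..T}.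
                      \<bar>K t $ r $ j - K u $ r $ j\<bar> \<le> Lip * \<bar>t - u\<bar>) \<longrightarrow>
               (\<forall>h. 0 < h \<and> h \<le> h0 \<longrightarrow>
                  (MAX m\<in>{..nat \<lfloor>T / h\<rfloor>}. norm (K (real m * h) - Kh h m))
                    \<le> C * Lip * h)))
       \<and> ((\<forall>i j. has_C1_density_on T (\<lambda>t. Q t $ i $ j)) \<and>
          (\<forall>r j. C2_on {0..T} (\<lambda>t. K t $ r $ j)) \<longrightarrow>
          (\<lambda>h. MAX m\<in>{..nat \<lfloor>T / h\<rfloor>}. norm (K (real m * h) - Kh h m))
            \<in> O[at_right 0](\<lambda>h. h\<^sup>2))"
proof -
  interpret substochastic_kernel Q by (rule semi_markov_kernel_imp_substochastic[OF kernel])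
  let ?G = "\<lambda>i r x. Q (max 0 x) $ i $ r"
  let ?err = "\<lambda>h. MAX m\<in>{..nat \<lfloor>T / h\<rfloor>}. norm (K (real m * h) - Kh h m)"
  have "\<And>t. 0 \<le> t \<Longrightarrow> K t = L t + stieltjes_conv Q K t"
    using renewal unfolding markov_renewal_solution_def by blast
  from mean_value_error[OF this discrete T_pos K_cont]
  obtain h0 C where h0: "0 < h0" and C: "0 \<le> C"
    and main: "\<And>h \<epsilon> \<eta> m. 0 < h \<Longrightarrow> h \<le> h0 \<Longrightarrow> 0 \<le> \<epsilon> \<Longrightarrow> 0 \<le> \<eta> \<Longrightarrow>
      (\<And>t a i r j. 0 \<le> a \<Longrightarrow> a + h \<le> t \<Longrightarrow> t \<le> T \<Longrightarrow>
        \<bar>LINT x:{a<..a + h}|interval_measure (?G i r).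
          K (t - x) $ r $ j - (K (t - a) $ r $ j + K (t - (a + h)) $ r $ j) / 2\<bar>
        \<le> \<epsilon> * (Q (a + h) $ i $ r - Q a $ i $ r) + \<eta> * h) \<Longrightarrow>
      m \<le> nat \<lfloor>T / h\<rfloor> \<Longrightarrow> norm (K (real m * h) - Kh h m) \<le> C * (\<epsilon> + \<eta>)"
    by blast
  have shift_cont: "continuous_on {a..b} (\<lambda>x. K (t - x) $ r $ j)"
    if "0 \<le> a" "b \<le> t" "t \<le> T" for a b t r j
    using that by (intro continuous_intros continuous_on_compose2[OF K_cont]) auto
  have modulus: "?err h \<le> C * modulus_of_continuity K h T" if h: "0 < h" "h \<le> h0" for h
  proof -
    \<comment> \<open>Here \<open>\<epsilon>\<close> is the modulus of continuity and
      \<open>\<eta> = 0\<close>.\<close>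
    have "norm (K (real m * h) - Kh h m) \<le> C * (modulus_of_continuity K h T + 0)"
      if m: "m \<le> nat \<lfloor>T / h\<rfloor>" for m
    proof (rule main[OF h _ _ _ m])
      show "0 \<le> modulus_of_continuity K h T"
        using abs_diff_le_modulus[OF K_cont, of 0 0 h] T_pos h by simp
      fix t a :: real and i r j assume at: "0 \<le> a" "a + h \<le> t" "t \<le> T"
      interpret stieltjes_integrator "?G i r" by (rule integrator)
      have "\<bar>LINT x:{a<..a + h}|interval_measure (?G i r).
          K (t - x) $ r $ j - (K (t - a) $ r $ j + K (t - (a + h)) $ r $ j) / 2\<bar>
        \<le> modulus_of_continuity K h T * (?G i r (a + h) - ?G i r a)"
      proof (rule local_error_le_oscillation)
        show "continuous_on {a..a + h} (\<lambda>x. K (t - x) $ r $ j)" using at by (intro shift_cont)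
        fix x y assume "x \<in> {a..a + h}" "y \<in> {a..a + h}"
        then show "\<bar>K (t - x) $ r $ j - K (t - y) $ r $ j\<bar> \<le> modulus_of_continuity K h T"
          using at by (intro abs_diff_le_modulus[OF K_cont]) auto
      qed (use h in simp)
      then show "\<bar>LINT x:{a<..a + h}|interval_measure (?G i r).
          K (t - x) $ r $ j - (K (t - a) $ r $ j + K (t - (a + h)) $ r $ j) / 2\<bar>
        \<le> modulus_of_continuity K h T * (Q (a + h) $ i $ r - Q a $ i $ r) + 0 * h"
        using at h by simp
    qed simp
    then show ?thesis by (intro Max.boundedI) auto
  qed
  have lipschitz: "?err h \<le> C * Lip * h"
    if lip: "\<forall>r j. \<forall>t\<in>{0..T}. \<forall>u\<in>{0..T}. \<bar>K t $ r $ j - K u $ r $ j\<bar> \<le> Lip * \<bar>t - u\<bar>"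
      and h: "0 < h" "h \<le> h0" for Lip h
  proof -
    have "modulus_of_continuity K h T \<le> Lip * h"
      using lip T_pos h by (intro modulus_le_lipschitz) auto
    from order_trans[OF modulus[OF h] mult_left_mono[OF this C]]
    show ?thesis by (simp only: mult.assoc)
  qed
  have second_order: "?err \<in> O[at_right 0](\<lambda>h. h\<^sup>2)"
    if density: "\<forall>i j. has_C1_density_on T (\<lambda>t. Q t $ i $ j)"
      and C2: "\<forall>r j. C2_on {0..T} (\<lambda>t. K t $ r $ j)"
  proof -
    \<comment> \<open>The density is hidden behind an existential quantifier so that the predicate
      is monotone in \<open>D\<close> alone, as \<open>finite_uniform_bound\<close> requires.
      \<open>expands\<close> below is built in the same way; index pairs are handled as a single
      \<open>p\<close>.\<close>
    define lip_density where "lip_density i r D \<longleftrightarrow> (\<exists>q.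
        (\<forall>x\<in>{0..T}. ((\<lambda>t. Q t $ i $ r) has_real_derivative q x) (at x within {0..T})) \<and>
        (\<forall>x\<in>{0..T}. \<forall>y\<in>{0..T}. \<bar>q x - q y\<bar> \<le> D * \<bar>x - y\<bar>))" for i r D
    have lip_density_ex: "\<exists>D. lip_density i r D" for i r
    proof -
      have "has_C1_density_on T (\<lambda>t. Q t $ i $ r)" using density by blast
      then obtain q D where
        "\<And>x. x \<in> {0..T} \<Longrightarrow> ((\<lambda>t. Q t $ i $ r) has_real_derivative q x) (at x within {0..T})"
        "\<And>x y. x \<in> {0..T} \<Longrightarrow> y \<in> {0..T} \<Longrightarrow> \<bar>q x - q y\<bar> \<le> D * \<bar>x - y\<bar>"
        by (rule has_C1_density_derivative) blast
      then show ?thesis unfolding lip_density_def by blast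
    qed
    have lip_density_mono: "lip_density i r D'" if "lip_density i r D" "D \<le> D'" for i r D D'
      using that unfolding lip_density_def by (meson mult_right_mono abs_ge_zero order_trans)
    obtain D where D: "0 \<le> D" "\<And>p. lip_density (fst p) (snd p) D"
    proof (rule finite_uniform_bound[of "\<lambda>p. lip_density (fst p) (snd p)"])
      show "\<exists>D. lip_density (fst p) (snd p) D" for p by (rule lip_density_ex)
      show "lip_density (fst p) (snd p) D'" if "lip_density (fst p) (snd p) D" "D \<le> D'" for p D D'
        using that by (rule lip_density_mono)
    qed (rule that)
    define expands where "expands r j B \<longleftrightarrow> (\<exists>k'. (\<forall>x\<in>{0..T}. \<bar>k' x\<bar> \<le> B) \<and>
        (\<forall>u v y. 0 \<le> u \<longrightarrow> u \<le> y \<longrightarrow> y \<le> v \<longrightarrow> v \<le> T \<longrightarrow>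
          \<bar>K y $ r $ j - (K u $ r $ j + K v $ r $ j) / 2 - k' ((u + v) / 2) * (y - (u + v) / 2)\<bar>
            \<le> B * (v - u)\<^sup>2))" for r j B
    have expands_ex: "\<exists>B. expands r j B" for r j
    proof -
      have "C2_on {0..T} (\<lambda>t. K t $ r $ j)" using C2 by blast
      then obtain B k' where "\<And>x. x \<in> {0..T} \<Longrightarrow> \<bar>k' x\<bar> \<le> B"
        "\<And>u v y. 0 \<le> u \<Longrightarrow> u \<le> y \<Longrightarrow> y \<le> v \<Longrightarrow> v \<le> T \<Longrightarrow>
          \<bar>K y $ r $ j - (K u $ r $ j + K v $ r $ j) / 2 - k' ((u + v) / 2) * (y - (u + v) / 2)\<bar>
            \<le> B * (v - u)\<^sup>2"
        by (rule C2_on_midpoint_expansion) blast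
      then show ?thesis unfolding expands_def by blast
    qed
    have expands_mono: "expands r j B'" if "expands r j B" "B \<le> B'" for r j B B'
    proof -
      from that(1)[unfolded expands_def]
      obtain k' where k': "(\<forall>x\<in>{0..T}. \<bar>k' x\<bar> \<le> B) \<and>
        (\<forall>u v y. 0 \<le> u \<longrightarrow> u \<le> y \<longrightarrow> y \<le> v \<longrightarrow> v \<le> T \<longrightarrow>
          \<bar>K y $ r $ j - (K u $ r $ j + K v $ r $ j) / 2 - k' ((u + v) / 2) * (y - (u + v) / 2)\<bar>
            \<le> B * (v - u)\<^sup>2)"
        by (rule exE)
      have B': "B * (v - u)\<^sup>2 \<le> B' * (v - u)\<^sup>2" for u v
        by (intro mult_right_mono that(2)) simp
      show ?thesis unfolding expands_def
      proof (intro exI[of _ k'] conjI ballI allI impI)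
        show "\<bar>k' x\<bar> \<le> B'" if "x \<in> {0..T}" for x
          by (rule order_trans[OF bspec[OF conjunct1[OF k'] that] \<open>B \<le> B'\<close>])
        show "\<bar>K y $ r $ j - (K u $ r $ j + K v $ r $ j) / 2 - k' ((u + v) / 2) * (y - (u + v) / 2)\<bar>
            \<le> B' * (v - u)\<^sup>2" if "0 \<le> u" "u \<le> y" "y \<le> v" "v \<le> T" for u v y
          by (rule order_trans[OF conjunct2[OF k', rule_format, OF that] B'])
      qed
    qed
    obtain B where B: "0 \<le> B" "\<And>p. expands (fst p) (snd p) B"
    proof (rule finite_uniform_bound[of "\<lambda>p. expands (fst p) (snd p)"])
      show "\<exists>B. expands (fst p) (snd p) B" for p by (rule expands_ex)
      show "expands (fst p) (snd p) B'" if "expands (fst p) (snd p) B" "B \<le> B'" for p B B'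
        using that by (rule expands_mono)
    qed (rule that)
    have bound: "?err h \<le> C * (B + B * D) * h\<^sup>2" if h: "0 < h" "h \<le> h0" for h
    proof -
      \<comment> \<open>Both parameters are quadratic: \<open>\<epsilon>\<close> is \<open>B\<close>
        and \<open>\<eta>\<close> is \<open>B * D\<close>, each times
        \<open>h\<^sup>2\<close>.\<close>
      have "norm (K (real m * h) - Kh h m) \<le> C * (B * h\<^sup>2 + B * D * h\<^sup>2)"
        if m: "m \<le> nat \<lfloor>T / h\<rfloor>" for m
      proof (rule main[OF h _ _ _ m])
        fix t a :: real and i r j assume at: "0 \<le> a" "a + h \<le> t" "t \<le> T"
        interpret stieltjes_integrator "?G i r" by (rule integrator)
        obtain q where q: "\<And>x. x \<in> {0..T} \<Longrightarrow> ((\<lambda>t. Q t $ i $ r) has_real_derivative q x) (at x within {0..T})"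
          and lip: "\<And>x y. x \<in> {0..T} \<Longrightarrow> y \<in> {0..T} \<Longrightarrow> \<bar>q x - q y\<bar> \<le> D * \<bar>x - y\<bar>"
          using D(2)[of "(i, r)"] unfolding lip_density_def fst_conv snd_conv by blast
        from B(2)[of "(r, j)", unfolded expands_def fst_conv snd_conv]
        obtain k' where k'_expansion: "(\<forall>x\<in>{0..T}. \<bar>k' x\<bar> \<le> B) \<and>
          (\<forall>u v y. 0 \<le> u \<longrightarrow> u \<le> y \<longrightarrow> y \<le> v \<longrightarrow> v \<le> T \<longrightarrow>
            \<bar>K y $ r $ j - (K u $ r $ j + K v $ r $ j) / 2 - k' ((u + v) / 2) * (y - (u + v) / 2)\<bar>
              \<le> B * (v - u)\<^sup>2)"
          by (rule exE)
        note k' = bspec[OF conjunct1[OF k'_expansion]]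
        note expansion = conjunct2[OF k'_expansion, rule_format]
        have deriv: "(?G i r has_real_derivative q x) (at x within {a..a + h})" if x: "x \<in> {a..a + h}" for x
        proof -
          have "((\<lambda>t. Q t $ i $ r) has_real_derivative q x) (at x within {a..a + h})"
            using at x by (intro DERIV_subset[OF q]) auto
          then show ?thesis unfolding has_field_derivative_def
            by (rule has_derivative_transform[OF x, rotated]) (use at in auto)
        qed
        have "\<bar>LINT x:{a<..a + h}|interval_measure (?G i r).
            K (t - x) $ r $ j - (K (t - a) $ r $ j + K (t - (a + h)) $ r $ j) / 2\<bar>
          \<le> B * (a + h - a)\<^sup>2 * (?G i r (a + h) - ?G i r a) + B * D * (a + h - a) ^ 3"
        \<comment> \<open>The slope carries a minus sign because
          \<open>x \<mapsto> K (t - x)\<close> reverses orientation: the cell is mapped onto the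
          interval from \<open>t - (a + h)\<close> to \<open>t - a\<close>, and midpoint to
          midpoint.\<close>
        proof (rule local_error_le_midpoint[where q = q and p = "- k' (t - (a + (a + h)) / 2)"])
          fix x assume x: "x \<in> {a..a + h}"
          let ?c = "(a + (a + h)) / 2"
          have mid: "(t - (a + h) + (t - a)) / 2 = t - ?c" by (simp add: field_simps)
          have "\<bar>K (t - x) $ r $ j - (K (t - (a + h)) $ r $ j + K (t - a) $ r $ j) / 2
              - k' (t - ?c) * (t - x - (t - ?c))\<bar> \<le> B * (t - a - (t - (a + h)))\<^sup>2"
            by (rule expansion[of "t - (a + h)" "t - x" "t - a", unfolded mid]) (use x at in auto)
          moreover have "t - a - (t - (a + h)) = a + h - a" by simp
          moreover have "k' (t - ?c) * (t - x - (t - ?c)) = - k' (t - ?c) * (x - ?c)"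
            by (simp add: right_diff_distrib)
          moreover have "K (t - (a + h)) $ r $ j + K (t - a) $ r $ j = K (t - a) $ r $ j + K (t - (a + h)) $ r $ j"
            by (rule add.commute)
          ultimately show "\<bar>K (t - x) $ r $ j - (K (t - a) $ r $ j + K (t - (a + h)) $ r $ j) / 2
              - - k' (t - ?c) * (x - ?c)\<bar> \<le> B * (a + h - a)\<^sup>2"
            by (simp only:)
        next
          show "\<bar>- k' (t - (a + (a + h)) / 2)\<bar> \<le> B"
            using at h by (auto simp: field_simps intro!: k')
        qed (use at h deriv lip D(1) shift_cont[of a "a + h" t r j] in auto)
        then show "\<bar>LINT x:{a<..a + h}|interval_measure (?G i r).
            K (t - x) $ r $ j - (K (t - a) $ r $ j + K (t - (a + h)) $ r $ j) / 2\<bar>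
          \<le> B * h\<^sup>2 * (Q (a + h) $ i $ r - Q a $ i $ r) + B * D * h\<^sup>2 * h"
          using at h by (simp add: power2_eq_square power3_eq_cube mult.assoc)
      qed (use B D in auto)
      then show ?thesis by (intro Max.boundedI) (auto simp: algebra_simps)
    qed
    \<comment> \<open>The Landau symbol involves the absolute value of \<open>?err h\<close>, which
      nonnegativity removes.\<close>
    have nonneg: "0 \<le> ?err h" for h
    proof -
      have "norm (K (real 0 * h) - Kh h 0) \<le> ?err h" by (intro Max_ge imageI) auto
      then show ?thesis by (rule order_trans[OF norm_ge_zero])
    qed
    show ?thesis
    proof (rule bigoI[of _ "C * (B + B * D)"])
      show "\<forall>\<^sub>F h in at_right 0. norm (?err h) \<le> C * (B + B * D) * norm (h\<^sup>2)"
        using eventually_at_right_real[OF h0]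
        by eventually_elim (use bound nonneg in auto)
    qed
  qed
  show ?thesis using h0 modulus lipschitz second_order by blast
qed

end
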